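(* Let $Y\in\mathcal{B}(H^2\oplus H^2)$. Then $$(S\oplus S^* )Y=Y(S\oplus S^* )^*$$ if and only if $$Y=\begin{pmatrix}0 & T_{\phi_{12}}\\ T^*_{\phi_{21}} & H_\psi\end{pmatrix}$$ for some $\phi_{12},\phi_{21}\in H^\infty$ and $\psi\in L^\infty$, where the block decomposition of $Y$ is with respect to $H^2\oplus H^2$.
   Context: $L^2,L^\infty$ are the square-integrable and essentially bounded functions on the unit circle $\mathbb{T}$; $H^2$ is the Hardy space, identified via boundary values with the closed subspace of $L^2$ of functions with vanishing negative Fourier coefficients; $H^\infty=L^\infty\cap H^2$; $P$ is the orthogonal projection of $L^2$ onto $H^2$. For $\phi\in L^\infty$, the Toeplitz operator is $T_\phi:H^2\to H^2$, $T_\phi h=P(\phi h)$, and the Hankel operator is $H_\phi:H^2\to H^2$, $H_\phi h=P\mathcal{J}(\phi h)$, where $\mathcal{J}:L^2\to L^2$, $(\mathcal{J}f)(z)=\overline z f(\overline z)$. $S=T_z$ is the unilateral shift on $H^2$. *)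

theory Defs
  imports "HOL-Analysis.Analysis"
begin

section \<open>Complex inner product spaces and their operators\<close>

text \<open>
  The library provides real inner product spaces only. The class below puts a compatible complex
  structure on top of \<^class>\<open>real_inner\<close>. The complex inner product is linear in its first
  argument and its real part is the library's \<^const>\<open>inner\<close>, so that norm and topology are the
  library's.
\<close>

class complex_inner = real_inner +
  fixes scaleC :: "complex \<Rightarrow> 'a \<Rightarrow> 'a" (infixr "*\<^sub>C" 75)
    and cinner :: "'a \<Rightarrow> 'a \<Rightarrow> complex"
  assumes scaleC_add_right: "a *\<^sub>C (x + y) = a *\<^sub>C x + a *\<^sub>C y"
    and scaleC_add_left: "(a + b) *\<^sub>C x = a *\<^sub>C x + b *\<^sub>C x"
    and scaleC_scaleC: "a *\<^sub>C b *\<^sub>C x = (a * b) *\<^sub>C x"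
    and scaleR_scaleC: "r *\<^sub>R x = complex_of_real r *\<^sub>C x"
    and cinner_commute: "cinner x y = cnj (cinner y x)"
    and cinner_add_left: "cinner (x + y) z = cinner x z + cinner y z"
    and cinner_scaleC_left: "cinner (a *\<^sub>C x) y = a * cinner x y"
    and inner_eq_Re_cinner: "inner x y = Re (cinner x y)"

definition bounded_clinear :: "('a::complex_inner \<Rightarrow> 'b::complex_inner) \<Rightarrow> bool" where
  "bounded_clinear A \<longleftrightarrow> bounded_linear A \<and> (\<forall>c x. A (c *\<^sub>C x) = c *\<^sub>C A x)"

text \<open>
  There is at most one operator with the defining property of the adjoint, and for bounded
  operators between Hilbert spaces there is one; for other \<open>A\<close> the value is unspecified.
\<close>

definition cadjoint :: "('a::complex_inner \<Rightarrow> 'b::complex_inner) \<Rightarrow> 'b \<Rightarrow> 'a" where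
  "cadjoint A = (THE B. \<forall>x y. cinner (A x) y = cinner x (B y))"

text \<open>
  The Hilbert space direct sum of two spaces is their product type: the library's inner product on
  pairs is already the sum of the inner products of the components.
\<close>

instantiation prod :: (complex_inner, complex_inner) complex_inner
begin

definition "c *\<^sub>C p = (c *\<^sub>C fst p, c *\<^sub>C snd p)"

definition "cinner p q = cinner (fst p) (fst q) + cinner (snd p) (snd q)"

instance
proof
  fix a b :: complex and r :: real and x y z :: "'a \<times> 'b"
  show "a *\<^sub>C (x + y) = a *\<^sub>C x + a *\<^sub>C y"
    by (simp add: scaleC_prod_def scaleC_add_right)
  show "(a + b) *\<^sub>C x = a *\<^sub>C x + b *\<^sub>C x"
    by (simp add: scaleC_prod_def scaleC_add_left)
  show "a *\<^sub>C b *\<^sub>C x = (a * b) *\<^sub>C x"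
    by (simp add: scaleC_prod_def scaleC_scaleC)
  show "r *\<^sub>R x = complex_of_real r *\<^sub>C x"
    by (simp add: scaleC_prod_def scaleR_prod_def scaleR_scaleC)
  show "cinner x y = cnj (cinner y x)"
    by (metis cinner_prod_def cinner_commute complex_cnj_add)
  show "cinner (x + y) z = cinner x z + cinner y z"
    by (simp add: cinner_prod_def cinner_add_left)
  show "cinner (a *\<^sub>C x) y = a * cinner x y"
    by (simp add: cinner_prod_def scaleC_prod_def cinner_scaleC_left distrib_left)
  show "inner x y = Re (cinner x y)"
    by (simp add: cinner_prod_def inner_prod_def inner_eq_Re_cinner)
qed

end

definition block_op ::
  "('a \<Rightarrow> 'c) \<Rightarrow> ('b \<Rightarrow> 'c) \<Rightarrow> ('a \<Rightarrow> 'd) \<Rightarrow> ('b \<Rightarrow> 'd) \<Rightarrow> 'a \<times> 'b \<Rightarrow>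
    'c::complex_inner \<times> 'd::complex_inner" where
  "block_op A B C D = (\<lambda>(x, y). (A x + B y, C x + D y))"


section \<open>The space \<open>L\<^sup>2\<close> of the unit circle\<close>

text \<open>
  Normalised arc length, as a Borel probability measure on the plane that is carried by the unit
  circle. Functions on the circle are represented by functions on the plane; since the measure
  does not see the complement of the circle, their values there are irrelevant.
\<close>

definition circle_measure :: "complex measure" where
  "circle_measure = distr (uniform_measure lborel {-pi..pi}) borel cis"

lemma sets_circle_measure [measurable_cong, simp]: "sets circle_measure = sets borel"
  by (simp add: circle_measure_def)

lemma space_circle_measure [simp]: "space circle_measure = UNIV"
  by (simp add: circle_measure_def)

lemma measurable_circle_measure [simp]:
  "borel_measurable circle_measure = borel_measurable borel"
  by (rule measurable_cong_sets) simp_all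

lemma cis_borel_measurable: "cis \<in> borel_measurable (uniform_measure lborel {-pi..pi})"
proof -
  have "cis \<in> borel_measurable borel"
    by (intro borel_measurable_continuous_onI continuous_intros)
  then show ?thesis
    by simp
qed

lemma cnj_borel_measurable [measurable]: "cnj \<in> borel_measurable borel"
  by (intro borel_measurable_continuous_onI continuous_intros)

lemma AE_circle_norm: "AE z in circle_measure. norm z = 1"
  unfolding circle_measure_def
  by (subst AE_distr_iff[OF cis_borel_measurable]) auto

lemma uniform_uminus:
  "distr (uniform_measure lborel {-pi..pi}) borel uminus = uniform_measure lborel {-pi..pi}"
proof (rule measure_eqI)
  fix A :: "real set"
  assume "A \<in> sets (distr (uniform_measure lborel {-pi..pi}) borel uminus)"
  then have A: "A \<in> sets borel" by simp
  have *: "uminus -` A \<in> sets (borel :: real measure)"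
    using measurable_sets[of uminus borel borel A] A by simp
  have "emeasure lborel ({-pi..pi} \<inter> uminus -` A)
      = emeasure (distr lborel borel uminus) ({-pi..pi} \<inter> A)"
    using A by (subst emeasure_distr) (auto intro!: arg_cong[where f = "emeasure lborel"])
  also have "\<dots> = emeasure lborel ({-pi..pi} \<inter> A)"
    by (simp add: lborel_distr_uminus)
  finally show "emeasure (distr (uniform_measure lborel {-pi..pi}) borel uminus) A
      = emeasure (uniform_measure lborel {-pi..pi}) A"
    using A * by (simp add: emeasure_distr)
qed simp

lemma circle_measure_cnj: "distr circle_measure borel cnj = circle_measure"
proof -
  have "distr circle_measure borel cnj
      = distr (uniform_measure lborel {-pi..pi}) borel (cis \<circ> uminus)"
    unfolding circle_measure_def
    by (subst distr_distr) (auto simp: cis_borel_measurable comp_def cis_cnj)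
  also have "\<dots> = distr (distr (uniform_measure lborel {-pi..pi}) borel uminus) borel cis"
    by (subst distr_distr) (auto simp: continuous_on_cis borel_measurable_continuous_onI)
  finally show ?thesis
    by (simp add: uniform_uminus circle_measure_def)
qed

definition square_integrable :: "(complex \<Rightarrow> complex) \<Rightarrow> bool" where
  "square_integrable f \<longleftrightarrow> f \<in> borel_measurable circle_measure \<and>
     integrable circle_measure (\<lambda>z. (norm (f z))\<^sup>2)"

definition L2_eq :: "(complex \<Rightarrow> complex) \<Rightarrow> (complex \<Rightarrow> complex) \<Rightarrow> bool" where
  "L2_eq f g \<longleftrightarrow> square_integrable f \<and> square_integrable g \<and>
     (AE z in circle_measure. f z = g z)"

lemma square_integrable_0: "square_integrable (\<lambda>_. 0)"
  by (simp add: square_integrable_def)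

lemma square_integrable_add:
  assumes "square_integrable f" "square_integrable g"
  shows "square_integrable (\<lambda>z. f z + g z)"
proof -
  have m [measurable]: "f \<in> borel_measurable borel" "g \<in> borel_measurable borel"
    using assms by (auto simp: square_integrable_def)
  have "(norm (f z + g z))\<^sup>2 \<le> 2 * (norm (f z))\<^sup>2 + 2 * (norm (g z))\<^sup>2" for z
  proof -
    have "(norm (f z + g z))\<^sup>2 \<le> (norm (f z) + norm (g z))\<^sup>2"
      by (intro power_mono norm_triangle_ineq) simp
    also have "\<dots> \<le> 2 * (norm (f z))\<^sup>2 + 2 * (norm (g z))\<^sup>2"
      using sum_squares_bound[of "norm (f z)" "norm (g z)"] by (simp add: power2_sum)
    finally show ?thesis .
  qed
  note bound = this
  have "integrable circle_measure (\<lambda>z. (norm (f z + g z))\<^sup>2)"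
  proof (rule Bochner_Integration.integrable_bound)
    show "integrable circle_measure (\<lambda>z. 2 * (norm (f z))\<^sup>2 + 2 * (norm (g z))\<^sup>2)"
      using assms by (simp add: square_integrable_def)
    show "(\<lambda>z. (norm (f z + g z))\<^sup>2) \<in> borel_measurable circle_measure"
      by simp
    show "AE z in circle_measure. norm ((norm (f z + g z))\<^sup>2)
        \<le> norm (2 * (norm (f z))\<^sup>2 + 2 * (norm (g z))\<^sup>2)"
      by (intro AE_I2) (simp add: bound)
  qed
  then show ?thesis
    by (simp add: square_integrable_def)
qed

lemma square_integrable_scale: "square_integrable f \<Longrightarrow> square_integrable (\<lambda>z. c * f z)"
  by (auto simp: square_integrable_def norm_mult power_mult_distrib)

lemma square_integrable_mult_cnj:
  assumes "square_integrable f" "square_integrable g"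
  shows "integrable circle_measure (\<lambda>z. f z * cnj (g z))"
proof -
  have m [measurable]: "f \<in> borel_measurable borel" "g \<in> borel_measurable borel"
    using assms by (auto simp: square_integrable_def)
  have "norm (f z * cnj (g z)) \<le> (norm (f z))\<^sup>2 + (norm (g z))\<^sup>2" for z
    using sum_squares_bound[of "norm (f z)" "norm (g z)"]
      mult_nonneg_nonneg[OF norm_ge_zero[of "f z"] norm_ge_zero[of "g z"]]
    unfolding norm_mult complex_mod_cnj mult.assoc by linarith
  note bound = this
  show ?thesis
  proof (rule Bochner_Integration.integrable_bound)
    show "integrable circle_measure (\<lambda>z. (norm (f z))\<^sup>2 + (norm (g z))\<^sup>2)"
      using assms by (simp add: square_integrable_def)
    show "(\<lambda>z. f z * cnj (g z)) \<in> borel_measurable circle_measure"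
      by simp
    show "AE z in circle_measure. norm (f z * cnj (g z))
        \<le> norm ((norm (f z))\<^sup>2 + (norm (g z))\<^sup>2)"
      using bound by (intro AE_I2) (simp only: real_norm_def, smt (verit) bound)
  qed
qed

lemma part_equivp_L2_eq: "part_equivp L2_eq"
proof (rule part_equivpI)
  show "\<exists>f. L2_eq f f"
    using square_integrable_0 by (auto simp: L2_eq_def)
  show "symp L2_eq"
    by (auto simp: symp_def L2_eq_def)
  show "transp L2_eq"
    by (auto simp: transp_def L2_eq_def)
qed

quotient_type L2 = "complex \<Rightarrow> complex" / partial: L2_eq
  by (rule part_equivp_L2_eq)

instantiation L2 :: complex_inner
begin

lift_definition zero_L2 :: L2 is "\<lambda>_. 0"
  by (simp add: L2_eq_def square_integrable_0)

lift_definition plus_L2 :: "L2 \<Rightarrow> L2 \<Rightarrow> L2" is "\<lambda>f g z. f z + g z"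
  by (auto simp: L2_eq_def square_integrable_add)

lift_definition scaleC_L2 :: "complex \<Rightarrow> L2 \<Rightarrow> L2" is "\<lambda>c f z. c * f z"
  by (auto simp: L2_eq_def square_integrable_scale)

lift_definition cinner_L2 :: "L2 \<Rightarrow> L2 \<Rightarrow> complex"
  is "\<lambda>f g. integral\<^sup>L circle_measure (\<lambda>z. f z * cnj (g z))"
  by (rule integral_cong_AE) (auto simp: L2_eq_def square_integrable_def)

definition uminus_L2 :: "L2 \<Rightarrow> L2" where "uminus_L2 f = (-1) *\<^sub>C f"
definition minus_L2 :: "L2 \<Rightarrow> L2 \<Rightarrow> L2" where "minus_L2 f g = f + - g"
definition scaleR_L2 :: "real \<Rightarrow> L2 \<Rightarrow> L2" where "scaleR_L2 r f = complex_of_real r *\<^sub>C f"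
definition inner_L2 :: "L2 \<Rightarrow> L2 \<Rightarrow> real" where "inner_L2 f g = Re (cinner f g)"
definition norm_L2 :: "L2 \<Rightarrow> real" where "norm_L2 f = sqrt (inner f f)"
definition sgn_L2 :: "L2 \<Rightarrow> L2" where "sgn_L2 f = inverse (norm f) *\<^sub>R f"
definition dist_L2 :: "L2 \<Rightarrow> L2 \<Rightarrow> real" where "dist_L2 f g = norm (f - g)"
definition [code del]:
  "(uniformity :: (L2 \<times> L2) filter) = (INF e\<in>{0 <..}. principal {(f, g). dist f g < e})"
definition open_L2 :: "L2 set \<Rightarrow> bool" where
  "open_L2 U = (\<forall>x\<in>U. eventually (\<lambda>(x', y). x' = x \<longrightarrow> y \<in> U) uniformity)"

instance
proof
  fix a b :: complex and r s :: real and x y z :: L2 and U :: "L2 set"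
  have scale_add_right: "a *\<^sub>C (x + y) = a *\<^sub>C x + a *\<^sub>C y" for a and x y :: L2
    by transfer (auto simp: L2_eq_def square_integrable_add square_integrable_scale distrib_left)
  have scale_add_left: "(a + b) *\<^sub>C x = a *\<^sub>C x + b *\<^sub>C x" for a b and x :: L2
    by transfer (auto simp: L2_eq_def square_integrable_add square_integrable_scale distrib_right)
  have scale_scale: "a *\<^sub>C b *\<^sub>C x = (a * b) *\<^sub>C x" for a b and x :: L2
    by transfer (auto simp: L2_eq_def square_integrable_scale mult.assoc)
  have scale_one: "1 *\<^sub>C x = x" for x :: L2
    by transfer (auto simp: L2_eq_def)
  have scale_zero: "0 *\<^sub>C x = 0" for x :: L2
    by transfer (auto simp: L2_eq_def square_integrable_0)
  have cadd: "cinner (x + y) z = cinner x z + cinner y z" for x y z :: L2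
    by transfer (auto simp: L2_eq_def distrib_right
        intro!: Bochner_Integration.integral_add square_integrable_mult_cnj)
  have cscale: "cinner (a *\<^sub>C x) y = a * cinner x y" for a and x y :: L2
    by transfer (auto simp: L2_eq_def mult.assoc)
  have ccomm: "cinner x y = cnj (cinner y x)" for x y :: L2
  proof transfer
    fix f g :: "complex \<Rightarrow> complex"
    have "cnj (integral\<^sup>L circle_measure (\<lambda>z. g z * cnj (f z)))
        = integral\<^sup>L circle_measure (\<lambda>z. cnj (g z * cnj (f z)))"
      by (rule Bochner_Integration.integral_cnj[symmetric])
    then show "integral\<^sup>L circle_measure (\<lambda>z. f z * cnj (g z))
        = cnj (integral\<^sup>L circle_measure (\<lambda>z. g z * cnj (f z)))"
      by (simp add: mult.commute)
  qed
  show "x + y + z = x + (y + z)"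
    by transfer (auto simp: L2_eq_def square_integrable_add add.assoc)
  show "x + y = y + x"
    by transfer (auto simp: L2_eq_def square_integrable_add add.commute)
  show zero_add: "0 + x = x"
    by transfer (auto simp: L2_eq_def)
  show "- x + x = 0"
    using scale_add_left[of "-1" 1 x] by (simp add: uminus_L2_def scale_one scale_zero)
  show "x - y = x + - y"
    by (rule minus_L2_def)
  show "r *\<^sub>R (x + y) = r *\<^sub>R x + r *\<^sub>R y"
    by (simp add: scaleR_L2_def scale_add_right)
  show "(r + s) *\<^sub>R x = r *\<^sub>R x + s *\<^sub>R x"
    by (simp add: scaleR_L2_def scale_add_left)
  show "r *\<^sub>R s *\<^sub>R x = (r * s) *\<^sub>R x"
    by (simp add: scaleR_L2_def scale_scale)
  show "1 *\<^sub>R x = x"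
    by (simp add: scaleR_L2_def scale_one)
  show "dist x y = norm (x - y)"
    by (rule dist_L2_def)
  show "sgn x = inverse (norm x) *\<^sub>R x"
    by (rule sgn_L2_def)
  show "(uniformity :: (L2 \<times> L2) filter) = (INF e\<in>{0 <..}. principal {(f, g). dist f g < e})"
    by (rule uniformity_L2_def)
  show "open U = (\<forall>x\<in>U. eventually (\<lambda>(x', y). x' = x \<longrightarrow> y \<in> U) uniformity)"
    by (rule open_L2_def)
  show "inner x y = inner y x"
    using ccomm[of x y] by (simp add: inner_L2_def)
  show "inner (x + y) z = inner x z + inner y z"
    by (simp add: inner_L2_def cadd)
  show "inner (r *\<^sub>R x) y = r * inner x y"
    by (simp add: inner_L2_def scaleR_L2_def cscale)
  have Re_eq: "Re (integral\<^sup>L circle_measure (\<lambda>z. f z * cnj (f z)))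
      = integral\<^sup>L circle_measure (\<lambda>z. (norm (f z))\<^sup>2)" if "square_integrable f" for f
    by (simp only: complex_norm_square[symmetric] integral_complex_of_real Re_complex_of_real)
  show "0 \<le> inner x x"
    unfolding inner_L2_def
    by transfer (auto simp: L2_eq_def Re_eq)
  show "inner x x = 0 \<longleftrightarrow> x = 0"
    unfolding inner_L2_def
  proof transfer
    fix f assume "L2_eq f f"
    then have f: "square_integrable f" by (simp add: L2_eq_def)
    then have "integral\<^sup>L circle_measure (\<lambda>z. (norm (f z))\<^sup>2) = 0
        \<longleftrightarrow> (AE z in circle_measure. (norm (f z))\<^sup>2 = 0)"
      by (intro integral_nonneg_eq_0_iff_AE) (auto simp: square_integrable_def)
    then show "Re (integral\<^sup>L circle_measure (\<lambda>z. f z * cnj (f z))) = 0 \<longleftrightarrow> L2_eq f (\<lambda>_. 0)"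
      using f by (simp add: Re_eq L2_eq_def square_integrable_0)
  qed
  show "norm x = sqrt (inner x x)"
    by (rule norm_L2_def)
  show "a *\<^sub>C (x + y) = a *\<^sub>C x + a *\<^sub>C y" by (rule scale_add_right)
  show "(a + b) *\<^sub>C x = a *\<^sub>C x + b *\<^sub>C x" by (rule scale_add_left)
  show "a *\<^sub>C b *\<^sub>C x = (a * b) *\<^sub>C x" by (rule scale_scale)
  show "r *\<^sub>R x = complex_of_real r *\<^sub>C x" by (rule scaleR_L2_def)
  show "cinner x y = cnj (cinner y x)" by (rule ccomm)
  show "cinner (x + y) z = cinner x z + cinner y z" by (rule cadd)
  show "cinner (a *\<^sub>C x) y = a * cinner x y" by (rule cscale)
  show "inner x y = Re (cinner x y)" by (rule inner_L2_def)
qed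

end


section \<open>Hardy space, bounded functions, and operators\<close>

lift_definition fourier_coeff :: "L2 \<Rightarrow> int \<Rightarrow> complex"
  is "\<lambda>f n. integral\<^sup>L circle_measure (\<lambda>z. f z * cnj (z powi n))"
proof (rule ext)
  fix f g :: "complex \<Rightarrow> complex" and n :: int
  assume fg: "L2_eq f g"
  have [measurable]: "(\<lambda>z::complex. z powi n) \<in> borel_measurable borel"
    by (simp add: power_int_def)
  show "integral\<^sup>L circle_measure (\<lambda>z. f z * cnj (z powi n))
      = integral\<^sup>L circle_measure (\<lambda>z. g z * cnj (z powi n))"
  proof (rule integral_cong_AE)
    have [measurable]: "f \<in> borel_measurable borel" "g \<in> borel_measurable borel"
      using fg by (auto simp: L2_eq_def square_integrable_def)
    show "(\<lambda>z. f z * cnj (z powi n)) \<in> borel_measurable circle_measure"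
      and "(\<lambda>z. g z * cnj (z powi n)) \<in> borel_measurable circle_measure"
      by simp_all
    have "AE z in circle_measure. f z = g z"
      using fg by (simp add: L2_eq_def)
    then show "AE z in circle_measure. f z * cnj (z powi n) = g z * cnj (z powi n)"
      by eventually_elim simp
  qed
qed

definition H2_set :: "L2 set" where
  "H2_set = {f. \<forall>n<0. fourier_coeff f n = 0}"

text \<open>Since the circle has finite measure, \<open>L\<^sup>\<infinity>\<close> is a subset of \<open>L\<^sup>2\<close>.\<close>

lift_definition ess_bounded :: "L2 \<Rightarrow> bool"
  is "\<lambda>f. \<exists>C::real. AE z in circle_measure. norm (f z) \<le> C"
proof -
  have *: "\<exists>C::real. AE z in circle_measure. norm (g z) \<le> C"
    if "L2_eq f g" and "\<exists>C::real. AE z in circle_measure. norm (f z) \<le> C"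
    for f g :: "complex \<Rightarrow> complex"
  proof -
    from that obtain C where "AE z in circle_measure. norm (f z) \<le> C" by blast
    moreover have "AE z in circle_measure. f z = g z"
      using that by (simp add: L2_eq_def)
    ultimately have "AE z in circle_measure. norm (g z) \<le> C"
      by eventually_elim simp
    then show ?thesis by blast
  qed
  fix f g :: "complex \<Rightarrow> complex"
  assume fg: "L2_eq f g"
  then have gf: "L2_eq g f"
    by (auto simp: L2_eq_def)
  show "(\<exists>C::real. AE z in circle_measure. norm (f z) \<le> C) \<longleftrightarrow>
      (\<exists>C::real. AE z in circle_measure. norm (g z) \<le> C)"
    using *[OF fg] *[OF gf] by (rule iffI)
qed

definition Linf :: "L2 set" where
  "Linf = {f. ess_bounded f}"

definition Hinf :: "L2 set" where
  "Hinf = Linf \<inter> H2_set"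

text \<open>
  The pointwise product of two classes is again in \<open>L\<^sup>2\<close> when the first factor lies in
  \<^term>\<open>Linf\<close>, and it is used only in that case.
\<close>

definition mult_L2 :: "L2 \<Rightarrow> L2 \<Rightarrow> L2" where
  "mult_L2 \<phi> f = abs_L2 (\<lambda>z. rep_L2 \<phi> z * rep_L2 f z)"

lemma square_integrable_cong_L2_eq:
  assumes "f \<in> borel_measurable borel" "square_integrable g" "AE z in circle_measure. f z = g z"
  shows "L2_eq f g"
proof -
  have "integrable circle_measure (\<lambda>z. (norm (f z))\<^sup>2)
      \<longleftrightarrow> integrable circle_measure (\<lambda>z. (norm (g z))\<^sup>2)"
    using assms by (intro integrable_cong_AE) (auto simp: square_integrable_def)
  then show ?thesis
    using assms by (auto simp: L2_eq_def square_integrable_def)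
qed

lemma mult_L2_abs:
  assumes "square_integrable f" "square_integrable g" "ess_bounded (abs_L2 f)"
  shows "square_integrable (\<lambda>z. f z * g z)"
    and "mult_L2 (abs_L2 f) (abs_L2 g) = abs_L2 (\<lambda>z. f z * g z)"
proof -
  have m [measurable]: "f \<in> borel_measurable borel" "g \<in> borel_measurable borel"
    using assms by (auto simp: square_integrable_def)
  have ff: "L2_eq f f" and gg: "L2_eq g g"
    using assms by (auto simp: L2_eq_def)
  obtain C :: real where C: "AE z in circle_measure. norm (f z) \<le> C"
    using assms(3) ff by (auto simp: ess_bounded.abs_eq)
  have le: "AE z in circle_measure. norm ((norm (f z * g z))\<^sup>2) \<le> norm (C\<^sup>2 * (norm (g z))\<^sup>2)"
    using C
  proof (rule eventually_mono)
    fix z assume "norm (f z) \<le> C"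
    then have "(norm (f z))\<^sup>2 \<le> C\<^sup>2"
      by (rule power_mono) simp
    then have "(norm (f z))\<^sup>2 * (norm (g z))\<^sup>2 \<le> C\<^sup>2 * (norm (g z))\<^sup>2"
      by (rule mult_right_mono) simp
    then show "norm ((norm (f z * g z))\<^sup>2) \<le> norm (C\<^sup>2 * (norm (g z))\<^sup>2)"
      by (simp only: real_norm_def abs_mult abs_power2 norm_mult power_mult_distrib)
  qed
  have int: "integrable circle_measure (\<lambda>z. C\<^sup>2 * (norm (g z))\<^sup>2)"
    using assms by (simp add: square_integrable_def)
  have meas: "(\<lambda>z. (norm (f z * g z))\<^sup>2) \<in> borel_measurable circle_measure"
    by simp
  have "integrable circle_measure (\<lambda>z. (norm (f z * g z))\<^sup>2)"
    by (rule Bochner_Integration.integrable_bound[OF int meas le])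
  then show sq: "square_integrable (\<lambda>z. f z * g z)"
    by (simp add: square_integrable_def)
  have rf: "L2_eq (rep_L2 (abs_L2 f)) f" and rg: "L2_eq (rep_L2 (abs_L2 g)) g"
    by (rule rep_abs_rsp_left[OF Quotient3_L2, OF ff], rule rep_abs_rsp_left[OF Quotient3_L2, OF gg])
  have "L2_eq (\<lambda>z. rep_L2 (abs_L2 f) z * rep_L2 (abs_L2 g) z) (\<lambda>z. f z * g z)"
  proof (rule square_integrable_cong_L2_eq[OF _ sq])
    have [measurable]: "rep_L2 (abs_L2 f) \<in> borel_measurable borel"
        "rep_L2 (abs_L2 g) \<in> borel_measurable borel"
      using rf rg by (auto simp: L2_eq_def square_integrable_def)
    show "(\<lambda>z. rep_L2 (abs_L2 f) z * rep_L2 (abs_L2 g) z) \<in> borel_measurable borel"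
      by simp
    have "AE z in circle_measure. rep_L2 (abs_L2 f) z = f z"
        "AE z in circle_measure. rep_L2 (abs_L2 g) z = g z"
      using rf rg by (simp_all add: L2_eq_def)
    then show "AE z in circle_measure. rep_L2 (abs_L2 f) z * rep_L2 (abs_L2 g) z = f z * g z"
      by eventually_elim simp
  qed
  then show "mult_L2 (abs_L2 f) (abs_L2 g) = abs_L2 (\<lambda>z. f z * g z)"
    unfolding mult_L2_def by (rule Quotient3_rel_abs[OF Quotient3_L2])
qed

text \<open>The operator \<open>\<J>\<close> with \<open>(\<J> f)(z) = cnj z * f (cnj z)\<close>.\<close>

lift_definition flip_L2 :: "L2 \<Rightarrow> L2" is "\<lambda>f z. cnj z * f (cnj z)"
proof -
  fix f g :: "complex \<Rightarrow> complex"
  assume fg: "L2_eq f g"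
  then have m [measurable]: "f \<in> borel_measurable borel" "g \<in> borel_measurable borel"
    by (auto simp: L2_eq_def square_integrable_def)
  have cnj_m: "cnj \<in> borel_measurable circle_measure"
    by simp
  have "AE z in distr circle_measure borel cnj. f z = g z"
    unfolding circle_measure_cnj using fg by (simp add: L2_eq_def)
  then have AE: "AE z in circle_measure. f (cnj z) = g (cnj z)"
    by (subst (asm) AE_distr_iff[OF cnj_m]) auto
  have sq: "square_integrable (\<lambda>z. cnj z * h (cnj z))" if "square_integrable h" for h
  proof -
    have [measurable]: "h \<in> borel_measurable borel"
      using that by (simp add: square_integrable_def)
    have "integrable (distr circle_measure borel cnj) (\<lambda>z. (norm (h z))\<^sup>2)"
      using that by (simp add: circle_measure_cnj square_integrable_def)
    then have "integrable circle_measure (\<lambda>z. (norm (h (cnj z)))\<^sup>2)"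
      by (subst (asm) integrable_distr_eq[OF cnj_m]) auto
    moreover have "AE z in circle_measure. (norm (h (cnj z)))\<^sup>2 = (norm (cnj z * h (cnj z)))\<^sup>2"
      using AE_circle_norm by eventually_elim (simp add: norm_mult)
    ultimately have "integrable circle_measure (\<lambda>z. (norm (cnj z * h (cnj z)))\<^sup>2)"
      by (subst (asm) integrable_cong_AE) auto
    then show ?thesis
      by (simp add: square_integrable_def)
  qed
  show "L2_eq (\<lambda>z. cnj z * f (cnj z)) (\<lambda>z. cnj z * g (cnj z))"
    using fg AE by (auto simp: L2_eq_def sq)
qed

lemma fourier_coeff_zero: "fourier_coeff 0 n = 0"
  by transfer simp

lemma fourier_coeff_scaleC: "fourier_coeff (c *\<^sub>C f) n = c * fourier_coeff f n"
  by transfer (simp add: mult.assoc)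

lemma fourier_coeff_add: "fourier_coeff (f + g) n = fourier_coeff f n + fourier_coeff g n"
proof transfer
  fix f g :: "complex \<Rightarrow> complex" and n :: int
  assume fg: "L2_eq f f" "L2_eq g g"
  have [measurable]: "(\<lambda>z::complex. z powi n) \<in> borel_measurable borel"
    by (simp add: power_int_def)
  have "AE z in circle_measure. (norm (z powi n))\<^sup>2 = (1::real)"
    using AE_circle_norm by eventually_elim (simp add: norm_power_int)
  moreover have "finite_measure circle_measure"
    unfolding circle_measure_def
    by (intro finite_measure.finite_measure_distr cis_borel_measurable)
       (simp add: finite_measureI)
  ultimately have "integrable circle_measure (\<lambda>z. (norm (z powi n))\<^sup>2)"
    by (subst integrable_cong_AE[where g = "\<lambda>_. 1"])
       (auto intro!: finite_measure.integrable_const)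
  then have "square_integrable (\<lambda>z. z powi n)"
    by (simp add: square_integrable_def)
  then show "integral\<^sup>L circle_measure (\<lambda>z. (f z + g z) * cnj (z powi n))
      = integral\<^sup>L circle_measure (\<lambda>z. f z * cnj (z powi n))
        + integral\<^sup>L circle_measure (\<lambda>z. g z * cnj (z powi n))"
    using fg unfolding distrib_right
    by (intro Bochner_Integration.integral_add square_integrable_mult_cnj)
       (auto simp: L2_eq_def)
qed

typedef H2 = H2_set
  morphisms H2_to_L2 Abs_H2
  by (rule exI[of _ 0]) (simp add: H2_set_def fourier_coeff_zero)

setup_lifting type_definition_H2

instantiation H2 :: complex_inner
begin

lift_definition zero_H2 :: H2 is 0
  by (simp add: H2_set_def fourier_coeff_zero)

lift_definition plus_H2 :: "H2 \<Rightarrow> H2 \<Rightarrow> H2" is "(+)"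
  by (simp add: H2_set_def fourier_coeff_add)

lift_definition scaleC_H2 :: "complex \<Rightarrow> H2 \<Rightarrow> H2" is "(*\<^sub>C)"
  by (simp add: H2_set_def fourier_coeff_scaleC)

lift_definition cinner_H2 :: "H2 \<Rightarrow> H2 \<Rightarrow> complex" is cinner .

lift_definition uminus_H2 :: "H2 \<Rightarrow> H2" is uminus
  by (simp add: H2_set_def uminus_L2_def fourier_coeff_scaleC)

lift_definition minus_H2 :: "H2 \<Rightarrow> H2 \<Rightarrow> H2" is "(-)"
  by (simp add: H2_set_def minus_L2_def uminus_L2_def fourier_coeff_add fourier_coeff_scaleC)

lift_definition scaleR_H2 :: "real \<Rightarrow> H2 \<Rightarrow> H2" is "(*\<^sub>R)"
  by (simp add: H2_set_def scaleR_L2_def fourier_coeff_scaleC)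

lift_definition inner_H2 :: "H2 \<Rightarrow> H2 \<Rightarrow> real" is inner .

lift_definition norm_H2 :: "H2 \<Rightarrow> real" is norm .

definition sgn_H2 :: "H2 \<Rightarrow> H2" where "sgn_H2 f = inverse (norm f) *\<^sub>R f"
definition dist_H2 :: "H2 \<Rightarrow> H2 \<Rightarrow> real" where "dist_H2 f g = norm (f - g)"
definition [code del]:
  "(uniformity :: (H2 \<times> H2) filter) = (INF e\<in>{0 <..}. principal {(f, g). dist f g < e})"
definition open_H2 :: "H2 set \<Rightarrow> bool" where
  "open_H2 U = (\<forall>x\<in>U. eventually (\<lambda>(x', y). x' = x \<longrightarrow> y \<in> U) uniformity)"

instance
proof
  fix a b :: complex and r s :: real and x y z :: H2 and U :: "H2 set"
  show "x + y + z = x + (y + z)" by transfer (rule add.assoc)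
  show "x + y = y + x" by transfer (rule add.commute)
  show "0 + x = x" by transfer simp
  show "- x + x = 0" by transfer simp
  show "x - y = x + - y" by transfer simp
  show "r *\<^sub>R (x + y) = r *\<^sub>R x + r *\<^sub>R y" by transfer (rule scaleR_add_right)
  show "(r + s) *\<^sub>R x = r *\<^sub>R x + s *\<^sub>R x" by transfer (rule scaleR_add_left)
  show "r *\<^sub>R s *\<^sub>R x = (r * s) *\<^sub>R x" by transfer (rule scaleR_scaleR)
  show "1 *\<^sub>R x = x" by transfer simp
  show "dist x y = norm (x - y)" by (rule dist_H2_def)
  show "sgn x = inverse (norm x) *\<^sub>R x" by (rule sgn_H2_def)
  show "(uniformity :: (H2 \<times> H2) filter) = (INF e\<in>{0 <..}. principal {(f, g). dist f g < e})"
    by (rule uniformity_H2_def)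
  show "open U = (\<forall>x\<in>U. eventually (\<lambda>(x', y). x' = x \<longrightarrow> y \<in> U) uniformity)"
    by (rule open_H2_def)
  show "inner x y = inner y x" by transfer (rule inner_commute)
  show "inner (x + y) z = inner x z + inner y z" by transfer (rule inner_add_left)
  show "inner (r *\<^sub>R x) y = r * inner x y" by transfer simp
  show "0 \<le> inner x x" by transfer simp
  show "inner x x = 0 \<longleftrightarrow> x = 0" by transfer simp
  show "norm x = sqrt (inner x x)" by transfer (rule norm_eq_sqrt_inner)
  show "a *\<^sub>C (x + y) = a *\<^sub>C x + a *\<^sub>C y" by transfer (rule scaleC_add_right)
  show "(a + b) *\<^sub>C x = a *\<^sub>C x + b *\<^sub>C x" by transfer (rule scaleC_add_left)
  show "a *\<^sub>C b *\<^sub>C x = (a * b) *\<^sub>C x" by transfer (rule scaleC_scaleC)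
  show "r *\<^sub>R x = complex_of_real r *\<^sub>C x" by transfer (rule scaleR_scaleC)
  show "cinner x y = cnj (cinner y x)" by transfer (rule cinner_commute)
  show "cinner (x + y) z = cinner x z + cinner y z" by transfer (rule cinner_add_left)
  show "cinner (a *\<^sub>C x) y = a * cinner x y" by transfer (rule cinner_scaleC_left)
  show "inner x y = Re (cinner x y)" by transfer (rule inner_eq_Re_cinner)
qed

end

text \<open>
  The orthogonal projection of \<open>L\<^sup>2\<close> onto \<open>H\<^sup>2\<close>, with values in the type \<^typ>\<open>H2\<close>:
  \<open>g\<close> is the element of \<open>H\<^sup>2\<close> such that \<open>f - g\<close> is orthogonal to \<open>H\<^sup>2\<close>.
\<close>

definition proj_H2 :: "L2 \<Rightarrow> H2" where
  "proj_H2 f = (THE g. \<forall>h. cinner (f - H2_to_L2 g) (H2_to_L2 h) = 0)"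

definition toeplitz :: "L2 \<Rightarrow> H2 \<Rightarrow> H2" where
  "toeplitz \<phi> h = proj_H2 (mult_L2 \<phi> (H2_to_L2 h))"

definition hankel :: "L2 \<Rightarrow> H2 \<Rightarrow> H2" where
  "hankel \<phi> h = proj_H2 (flip_L2 (mult_L2 \<phi> (H2_to_L2 h)))"

definition shift :: "H2 \<Rightarrow> H2" where
  "shift = toeplitz (abs_L2 (\<lambda>z. z))"

end

theory Submission
  imports Defs
begin

text \<open>
  Write \<open>Y\<close> as a block matrix with entries \<open>A, B, C, D\<close>. The hypothesis says \<open>S A = A S\<^sup>*\<close>,
  \<open>S B = B S\<close>, \<open>S\<^sup>* C = C S\<^sup>*\<close> and \<open>S\<^sup>* D = D S\<close>. Since \<open>S\<^sup>*\<close> lowers the degree of a polynomial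
  and \<open>S\<close> is isometric, \<open>A\<close> kills all polynomials. The matrix of \<open>B\<close> depends on \<open>j - i\<close> only, and a
  bounded Laurent form \<open>\<Sum> g (j - i) p i cnj (q j)\<close> comes from a function in \<open>L\<^sup>\<infinity>\<close> with Fourier
  coefficients \<open>g\<close>; the same applies to \<open>C\<^sup>*\<close>. For \<open>D\<close> this is Nehari's theorem: the Hankel matrix
  \<open>(d (i + j))\<close>, \<open>i, j \<ge> 0\<close>, is extended by one coefficient \<open>d (-1), d (-2), \<dots>\<close> at a time, with
  control of the norm as in Parrott's lemma, until it fills a bounded Laurent matrix.
\<close>

section \<open>Fourier coefficients on the circle and completeness of \<open>L\<^sup>2\<close>\<close>

text \<open>Symbols are recovered from matrix entries alone, and
  \<open>laurent_form_imp_Linf\<close> is the common gate: it wants one bound valid for every window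
  \<open>{-N..N}\<close>. A Toeplitz matrix indexed by naturals supplies it, since translating the
  window into the nonnegative indices keeps \<open>j - i\<close>. A Hankel matrix shows only the
  negative coefficients of its symbol; the others have to be invented, one per extension step, and
  2N + 1 steps fill the window. The obstacle is the norm over infinitely many steps. Keeping it
  exactly is the limiting case of Parrott's lemma, where \<open>1 - A A* / \<tau>^2\<close> need not
  be invertible. Letting the bound grow from \<rho> to some \<tau> > \<rho> turns the equation for
  the corner into a contraction, and summable increments keep the total loss finite. Completeness of
  L^2, hence of H^2, turns square-summable sequences into vectors: the symbol before it is known to
  be bounded, the values of the adjoint, the projection.\<close>

lemma prob_circle_measure: "emeasure circle_measure UNIV = 1"
  unfolding circle_measure_def
  by (subst emeasure_distr[OF cis_borel_measurable])
     (auto simp: ennreal_divide_self divide_eq_1_ennreal pi_gt_zero)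

interpretation circle: finite_measure circle_measure
  by (rule finite_measureI) (simp add: prob_circle_measure)

lemma measure_circle_UNIV: "measure circle_measure UNIV = 1"
  by (simp add: measure_def prob_circle_measure)

lemma borel_measurable_powi [measurable]: "(\<lambda>z::complex. z powi n) \<in> borel_measurable borel"
  by (simp add: power_int_def)

lemma integral_circle_measure:
  fixes f :: "complex \<Rightarrow> complex"
  assumes [measurable]: "f \<in> borel_measurable borel"
  shows "integral\<^sup>L circle_measure f
    = (LINT x|lborel. indicator {-pi..pi} x *\<^sub>R f (cis x)) / (2 * pi)"
proof -
  have cis: "cis \<in> borel_measurable borel"
    by (intro borel_measurable_continuous_onI continuous_intros)
  have uni: "uniform_measure lborel {-pi..pi}
      = density lborel (\<lambda>x. ennreal (indicator {-pi..pi} x / (2 * pi)))"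
    unfolding uniform_measure_def
    by (intro arg_cong[where f = "density lborel"] ext)
       (auto simp: indicator_def divide_ennreal simp flip: ennreal_1)
  have "integral\<^sup>L circle_measure f = (LINT x|uniform_measure lborel {-pi..pi}. f (cis x))"
    unfolding circle_measure_def by (rule integral_distr[OF cis_borel_measurable]) simp
  also have "\<dots> = (LINT x|lborel. (indicator {-pi..pi} x / (2 * pi)) *\<^sub>R f (cis x))"
    unfolding uni using measurable_compose[OF cis assms]
    by (subst integral_density) auto
  also have "\<dots> = (LINT x|lborel. (1 / (2 * pi)) *\<^sub>R (indicator {-pi..pi} x *\<^sub>R f (cis x)))"
    by (intro Bochner_Integration.integral_cong) (auto simp: indicator_def)
  also have "\<dots> = (LINT x|lborel. indicator {-pi..pi} x *\<^sub>R f (cis x)) / (2 * pi)"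
    by (subst integral_scaleR_right) (simp add: scaleR_conv_of_real)
  finally show ?thesis .
qed

lemma integral_circle_powi:
  "integral\<^sup>L circle_measure (\<lambda>z. z powi n) = (if n = 0 then 1 else 0)"
proof (cases "n = 0")
  case True
  then show ?thesis by (simp add: measure_circle_UNIV)
next
  case False
  \<comment> \<open>An antiderivative of exp(i n x); its values at -pi and pi agree because
    \<open>n\<close> is an integer.\<close>
  define F where "F x = cis (real_of_int n * x) / (\<i> * of_int n)" for x
  have cis_powi: "cis x powi n = cis (real_of_int n * x)" for x
    by (simp add: cis_power_int)
  have vd: "(F has_vector_derivative cis (real_of_int n * x)) (at x within {-pi..pi})" for x
  proof -
    have "((\<lambda>z. exp (\<i> * of_int n * z) / (\<i> * of_int n)) has_field_derivative
        exp (\<i> * of_int n * of_real x)) (at (of_real x))"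
      using False by (auto intro!: derivative_eq_intros)
    then have "((\<lambda>x. exp (\<i> * of_int n * of_real x) / (\<i> * of_int n)) has_vector_derivative
        exp (\<i> * of_int n * of_real x)) (at x within {-pi..pi})"
      by (rule has_vector_derivative_real_field)
    then show ?thesis
      by (simp add: F_def[abs_def] cis_conv_exp mult_ac)
  qed
  have cont: "continuous_on {-pi..pi} (\<lambda>x. cis (real_of_int n * x))"
    by (intro continuous_intros)
  have "cis (real_of_int n * pi) = cis (real_of_int n * (-pi))"
  proof -
    have "cis (real_of_int n * pi) = cis (real_of_int n * (-pi)) * cis (2 * pi * of_int n)"
      unfolding cis_mult by (simp add: algebra_simps)
    then show ?thesis by simp
  qed
  then have "F pi = F (-pi)"
    by (simp add: F_def)
  then have "(LINT x|lborel. indicator {-pi..pi} x *\<^sub>R cis (real_of_int n * x)) = 0"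
    using integral_FTC_atLeastAtMost[OF _ vd cont] by simp
  then show ?thesis
    using False by (subst integral_circle_measure) (auto simp: cis_powi)
qed

lemma AE_circle_cnj_powi: "AE z in circle_measure. cnj (z powi n) = z powi (- n)"
  using AE_circle_norm
proof eventually_elim
  case (elim z)
  have "cnj z = inverse z"
    using elim complex_norm_square[of z] by (metis inverse_unique of_real_1 power_one)
  then show ?case by (simp add: power_int_minus power_int_inverse)
qed

lemma square_integrable_bounded:
  assumes [measurable]: "f \<in> borel_measurable borel" and "AE z in circle_measure. norm (f z) \<le> C"
  shows "square_integrable f"
  unfolding square_integrable_def
proof
  have "integrable circle_measure (\<lambda>z. C\<^sup>2)" by simp
  then show "integrable circle_measure (\<lambda>z. (norm (f z))\<^sup>2)"
  proof (rule Bochner_Integration.integrable_bound)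
    show "AE z in circle_measure. norm ((norm (f z))\<^sup>2) \<le> norm (C\<^sup>2)"
      using assms(2) by eventually_elim (simp add: power_mono)
  qed simp
qed simp

lemma AE_norm_powi: "AE z in circle_measure. norm (z powi n) \<le> 1"
  using AE_circle_norm by eventually_elim (simp add: norm_power_int)

lemma square_integrable_powi: "square_integrable (\<lambda>z. z powi n)"
  by (rule square_integrable_bounded[OF _ AE_norm_powi]) simp

lemma square_integrable_imp_integrable:
  assumes "square_integrable f"
  shows "integrable circle_measure f"
  using square_integrable_mult_cnj[OF assms square_integrable_powi[of 0]] by simp

lemma integrable_mult_bounded:
  fixes f g :: "complex \<Rightarrow> complex"
  assumes "integrable circle_measure f" and [measurable]: "g \<in> borel_measurable borel"
    and "AE z in circle_measure. norm (g z) \<le> C"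
  shows "integrable circle_measure (\<lambda>z. f z * g z)"
proof (rule Bochner_Integration.integrable_bound)
  show "integrable circle_measure (\<lambda>z. C * norm (f z))"
    using assms(1) by simp
  have [measurable]: "f \<in> borel_measurable borel"
    using assms(1) by (auto dest: borel_measurable_integrable)
  show "(\<lambda>z. f z * g z) \<in> borel_measurable circle_measure" by simp
  show "AE z in circle_measure. norm (f z * g z) \<le> norm (C * norm (f z))"
    using assms(3)
  proof eventually_elim
    case (elim z)
    have "norm (f z * g z) \<le> norm (f z) * C"
      unfolding norm_mult by (intro mult_left_mono elim) simp
    also have "\<dots> \<le> \<bar>norm (f z) * C\<bar>" by simp
    finally show ?case by (simp only: mult.commute real_norm_def)
  qed
qed

lemma borel_measurable_real_polynomial_function:
  "real_polynomial_function p \<Longrightarrow> (p :: complex \<Rightarrow> real) \<in> borel_measurable borel"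
  by (intro borel_measurable_continuous_onI continuous_on_polymonial_function)
     (simp add: real_polynomial_function_eq)

lemma AE_bounded_continuous:
  fixes p :: "complex \<Rightarrow> 'a::real_normed_vector"
  assumes "continuous_on UNIV p"
  obtains C where "AE z in circle_measure. norm (p z) \<le> C"
proof -
  have "bounded (p ` sphere 0 1)"
    by (intro compact_imp_bounded compact_continuous_image continuous_on_subset[OF assms]) auto
  then obtain C where "\<And>z. norm z = 1 \<Longrightarrow> norm (p z) \<le> C"
    unfolding bounded_iff by force
  then have "AE z in circle_measure. norm (p z) \<le> C"
    using AE_circle_norm by (auto elim: eventually_mono)
  then show ?thesis by (rule that)
qed

section \<open>Uniqueness: an integrable function on the circle is determined by its Fourier
  coefficients\<close>

definition coeff_null :: "(complex \<Rightarrow> complex) \<Rightarrow> bool" where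
  "coeff_null f \<longleftrightarrow> integrable circle_measure f \<and>
     (\<forall>n. integral\<^sup>L circle_measure (\<lambda>z. f z * z powi n) = 0)"

lemma integrable_mult_powi:
  "integrable circle_measure f \<Longrightarrow> integrable circle_measure (\<lambda>z. f z * z powi n)"
  by (rule integrable_mult_bounded[OF _ _ AE_norm_powi]) auto

lemma coeff_null_add:
  assumes "coeff_null f" "coeff_null g"
  shows "coeff_null (\<lambda>z. f z + g z)"
  using assms unfolding coeff_null_def by (auto simp: distrib_right integrable_mult_powi)

lemma coeff_null_scale: "coeff_null f \<Longrightarrow> coeff_null (\<lambda>z. c * f z)"
  unfolding coeff_null_def by (auto simp: mult.assoc)

lemma coeff_null_powi:
  assumes "coeff_null f"
  shows "coeff_null (\<lambda>z. f z * z powi k)"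
proof -
  have [measurable]: "f \<in> borel_measurable borel"
    using assms by (auto simp: coeff_null_def dest: borel_measurable_integrable)
  have "integral\<^sup>L circle_measure (\<lambda>z. f z * z powi k * z powi n)
      = integral\<^sup>L circle_measure (\<lambda>z. f z * z powi (k + n))" for n
  proof (rule integral_cong_AE)
    show "AE z in circle_measure. f z * z powi k * z powi n = f z * z powi (k + n)"
      using AE_circle_norm
    proof eventually_elim
      case (elim z)
      then have "z \<noteq> 0" by auto
      then show ?case by (simp add: power_int_add mult.assoc)
    qed
  qed simp_all
  then show ?thesis
    using assms by (auto simp: coeff_null_def integrable_mult_powi)
qed

lemma coeff_null_cong_AE:
  assumes "coeff_null f" "AE z in circle_measure. f z = g z" and [measurable]: "g \<in> borel_measurable borel"
  shows "coeff_null g"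
proof -
  have [measurable]: "f \<in> borel_measurable borel"
    using assms by (auto simp: coeff_null_def dest: borel_measurable_integrable)
  have "integrable circle_measure f \<longleftrightarrow> integrable circle_measure g"
    by (rule integrable_cong_AE) (use assms in auto)
  moreover have "integral\<^sup>L circle_measure (\<lambda>z. f z * z powi n)
      = integral\<^sup>L circle_measure (\<lambda>z. g z * z powi n)" for n
    by (rule integral_cong_AE) (use assms(2) in \<open>auto elim: eventually_mono\<close>)
  ultimately show ?thesis
    using assms(1) by (simp add: coeff_null_def)
qed

text \<open>
  The multipliers \<open>p\<close> preserving \<^const>\<open>coeff_null\<close> form an algebra containing \<open>Re\<close> and \<open>Im\<close>, which are
  combinations of \<open>z\<close> and its inverse on the circle.
\<close>

lemma coeff_null_polynomial:
  assumes "real_polynomial_function p" "coeff_null f"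
  shows "coeff_null (\<lambda>z. f z * of_real (p z))"
  using assms
proof (induction arbitrary: f)
  case (linear h)
  interpret h: bounded_linear h by (rule linear)
  have [measurable]: "f \<in> borel_measurable borel"
    using linear by (auto simp: coeff_null_def dest: borel_measurable_integrable)
  have hm [measurable]: "h \<in> borel_measurable borel"
    using linear borel_measurable_real_polynomial_function by auto
  let ?a = "complex_of_real (h 1)" and ?b = "complex_of_real (h \<i>)"
  have h_eq: "of_real (h z) = ((?a - \<i> * ?b) * z + (?a + \<i> * ?b) * cnj z) / 2" for z
  proof -
    have "h z = h (Re z *\<^sub>R 1 + Im z *\<^sub>R \<i>)"
      by (intro arg_cong[where f = h]) (simp add: complex_eq_iff)
    also have "\<dots> = Re z * h 1 + Im z * h \<i>"
      by (simp only: h.add h.scaleR real_scaleR_def)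
    finally show ?thesis
      by (simp add: complex_eq_iff field_simps)
  qed
  have "coeff_null (\<lambda>z. (?a - \<i> * ?b) / 2 * (f z * z powi 1) + (?a + \<i> * ?b) / 2 * (f z * z powi -1))"
    by (intro coeff_null_add coeff_null_scale coeff_null_powi linear)
  then show ?case
  proof (rule coeff_null_cong_AE)
    show "AE z in circle_measure. (?a - \<i> * ?b) / 2 * (f z * z powi 1)
        + (?a + \<i> * ?b) / 2 * (f z * z powi -1) = f z * of_real (h z)"
      using AE_circle_cnj_powi[of 1]
    proof eventually_elim
      case (elim z)
      then have "z powi -1 = cnj z" by (metis power_int_1_right)
      then show ?case by (subst (3) h_eq) (simp add: algebra_simps add_divide_distrib diff_divide_distrib)
    qed
  qed simp
next
  case (const c)
  then show ?case using coeff_null_scale[of f "of_real c"] by (simp add: mult.commute)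
next
  case (add p q)
  then show ?case using coeff_null_add by (simp add: distrib_left)
next
  case (mult p q)
  from mult.IH(2)[OF mult.IH(1)[OF mult.prems]] show ?case by (simp add: mult.assoc)
qed

text \<open>Stone-Weierstrass on the unit circle: \<open>g\<close> is a uniform limit there of real
  polynomials, whose products with \<open>f\<close> integrate to 0, and the error is at most the L^1
  norm \<open>I\<close> of \<open>f\<close> times \<open>e\<close>.\<close>

lemma coeff_null_continuous:
  fixes g :: "complex \<Rightarrow> real"
  assumes f: "coeff_null f" and g: "continuous_on UNIV g"
  shows "integral\<^sup>L circle_measure (\<lambda>z. f z * of_real (g z)) = 0"
proof -
  have fi: "integrable circle_measure f" using f by (simp add: coeff_null_def)
  have fm [measurable]: "f \<in> borel_measurable borel"
    using borel_measurable_integrable[OF fi] by simp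
  have gm [measurable]: "g \<in> borel_measurable borel"
    by (rule borel_measurable_continuous_onI[OF g])
  define I where "I = integral\<^sup>L circle_measure (\<lambda>z. norm (f z))"
  have I: "0 \<le> I" unfolding I_def by simp
  have "norm (integral\<^sup>L circle_measure (\<lambda>z. f z * of_real (g z))) \<le> I * e" if e: "e > 0" for e
  proof -
    obtain p where p: "real_polynomial_function p" "\<And>z. z \<in> sphere 0 1 \<Longrightarrow> \<bar>g z - p z\<bar> < e"
      using Stone_Weierstrass_real_polynomial_function[OF compact_sphere
          continuous_on_subset[OF g subset_UNIV] e] by metis
    have pm [measurable]: "p \<in> borel_measurable borel"
      by (rule borel_measurable_real_polynomial_function[OF p(1)])
    have np: "coeff_null (\<lambda>z. f z * of_real (p z))"
      by (rule coeff_null_polynomial[OF p(1) f])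
    have zero: "integral\<^sup>L circle_measure (\<lambda>z. f z * of_real (p z)) = 0"
      using np unfolding coeff_null_def by (auto dest: spec[of _ 0])
    have ip: "integrable circle_measure (\<lambda>z. f z * of_real (p z))"
      using np by (simp add: coeff_null_def)
    obtain C where C: "AE z in circle_measure. norm (g z) \<le> C"
      using AE_bounded_continuous[OF g] .
    have ig: "integrable circle_measure (\<lambda>z. f z * of_real (g z))"
      by (rule integrable_mult_bounded[OF fi, where C = C]) (use C in auto)
    have "integral\<^sup>L circle_measure (\<lambda>z. f z * of_real (g z))
        = integral\<^sup>L circle_measure (\<lambda>z. f z * of_real (g z) - f z * of_real (p z))"
      using ip ig zero by simp
    also have "norm \<dots> \<le> integral\<^sup>L circle_measure (\<lambda>z. norm (f z * of_real (g z) - f z * of_real (p z)))"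
      by (rule integral_norm_bound)
    also have "\<dots> \<le> integral\<^sup>L circle_measure (\<lambda>z. norm (f z) * e)"
    proof (rule integral_mono_AE)
      show "integrable circle_measure (\<lambda>z. norm (f z * of_real (g z) - f z * of_real (p z)))"
        using ip ig by simp
      show "integrable circle_measure (\<lambda>z. norm (f z) * e)" using fi by simp
      show "AE z in circle_measure. norm (f z * of_real (g z) - f z * of_real (p z)) \<le> norm (f z) * e"
        using AE_circle_norm
      proof eventually_elim
        case (elim z)
        have "norm (f z * of_real (g z) - f z * of_real (p z)) = norm (f z) * \<bar>g z - p z\<bar>"
          unfolding right_diff_distrib[symmetric] norm_mult of_real_diff[symmetric] norm_of_real ..
        also have "\<dots> \<le> norm (f z) * e"
          using p(2)[of z] elim by (intro mult_left_mono) auto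
        finally show ?case .
      qed
    qed
    also have "\<dots> = I * e" by (simp add: I_def)
    finally show ?thesis .
  qed
  note bound = this
  have "norm (integral\<^sup>L circle_measure (\<lambda>z. f z * of_real (g z))) \<le> 0"
  proof (rule field_le_epsilon)
    fix e :: real assume e: "e > 0"
    \<comment> \<open>Dividing by \<open>I + 1\<close> covers the case \<open>I = 0\<close>.\<close>
    have "I * (e / (I + 1)) \<le> e"
      using I e by (simp add: field_simps)
    then show "norm (integral\<^sup>L circle_measure (\<lambda>z. f z * of_real (g z))) \<le> 0 + e"
      using bound[of "e / (I + 1)"] I e by (simp add: divide_pos_pos add_nonneg_pos)
  qed
  then show ?thesis by simp
qed

text \<open>The continuous cutoffs \<open>g n\<close> decrease to the indicator of \<open>A\<close>,
  so dominated convergence with majorant \<open>norm (f z)\<close> applies.\<close>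

lemma coeff_null_closed:
  assumes f: "coeff_null f" and A: "closed A"
  shows "set_lebesgue_integral circle_measure A f = 0"
\<comment> \<open>\<open>infdist\<close> to the empty set is 0 by convention, so the cutoffs below
  would tend to 1 instead of 0.\<close>
proof (cases "A = {}")
  case True
  then show ?thesis by (simp add: set_lebesgue_integral_def)
next
  case False
  have fi: "integrable circle_measure f" using f by (simp add: coeff_null_def)
  have fm [measurable]: "f \<in> borel_measurable borel"
    using borel_measurable_integrable[OF fi] by simp
  define g where "g n z = max 0 (1 - real n * infdist z A)" for n z
  have gc: "continuous_on UNIV (g n)" for n
    unfolding g_def by (intro continuous_intros)
  have gm [measurable]: "g n \<in> borel_measurable borel" for n
    by (rule borel_measurable_continuous_onI[OF gc])
  have lim: "(\<lambda>n. g n z) \<longlonglongrightarrow> indicator A z" for z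
  proof (cases "z \<in> A")
    case True
    then show ?thesis by (simp add: g_def)
  next
    case zA: False
    then have pos: "infdist z A > 0"
      using in_closed_iff_infdist_zero[OF A False] infdist_nonneg[of z A] by force
    obtain N where N: "real N > 1 / infdist z A" using reals_Archimedean2 by blast
    have "eventually (\<lambda>n. g n z = 0) sequentially"
      using eventually_ge_at_top[of N]
    proof eventually_elim
      case (elim n)
      then have "1 / infdist z A \<le> real n" using N by simp
      then have "1 \<le> real n * infdist z A" using pos by (simp add: field_simps)
      then show ?case by (simp add: g_def)
    qed
    then show ?thesis using zA by (simp add: tendsto_eventually)
  qed
  have "(\<lambda>n. integral\<^sup>L circle_measure (\<lambda>z. f z * of_real (g n z)))
      \<longlonglongrightarrow> integral\<^sup>L circle_measure (\<lambda>z. f z * of_real (indicator A z))"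
  proof (rule integral_dominated_convergence[where w = "\<lambda>z. norm (f z)"])
    show "integrable circle_measure (\<lambda>z. norm (f z))" using fi by simp
    show "AE z in circle_measure. norm (f z * of_real (g n z)) \<le> norm (f z)" for n
    proof (rule AE_I2)
      fix z
      have "\<bar>g n z\<bar> \<le> 1" using infdist_nonneg[of z A] by (simp add: g_def)
      then show "norm (f z * of_real (g n z)) \<le> norm (f z)"
        by (simp add: norm_mult mult_left_le)
    qed
    show "AE z in circle_measure. (\<lambda>n. f z * of_real (g n z)) \<longlonglongrightarrow> f z * of_real (indicator A z)"
      by (intro AE_I2 tendsto_intros lim)
  qed (use borel_closed[OF A] in auto)
  then have "integral\<^sup>L circle_measure (\<lambda>z. f z * of_real (indicator A z)) = 0"
    by (simp add: coeff_null_continuous[OF f gc] LIMSEQ_const_iff)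
  then show ?thesis
    by (simp add: set_lebesgue_integral_def scaleR_conv_of_real mult.commute)
qed

text \<open>The sets over which \<open>f\<close> integrates to 0 form a Dynkin system containing the
  closed sets, which are stable under intersection and generate the Borel sets.\<close>

lemma coeff_null_AE_zero:
  assumes f: "coeff_null f"
  shows "AE z in circle_measure. f z = 0"
proof (rule circle.density_zero)
  show fi: "integrable circle_measure f" using f by (simp add: coeff_null_def)
  fix A assume "A \<in> sets circle_measure"
  then have A: "A \<in> sigma_sets UNIV (Collect closed :: complex set set)"
    by (simp add: borel_eq_closed)
  have "Int_stable (Collect closed :: complex set set)"
    by (auto simp: Int_stable_def)
  moreover have "(Collect closed :: complex set set) \<subseteq> Pow UNIV" by simp
  ultimately show "set_lebesgue_integral circle_measure A f = 0"
    using A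
  proof (induction rule: sigma_sets_induct_disjoint)
    case (basic A)
    then show ?case using coeff_null_closed[OF f] by simp
  next
    case empty
    then show ?case by (simp add: set_lebesgue_integral_def)
  next
    case (compl A)
    have A: "A \<in> sets circle_measure" using compl(1) by (simp add: borel_eq_closed)
    have "set_lebesgue_integral circle_measure (A \<union> (UNIV - A)) f
       = set_lebesgue_integral circle_measure A f + set_lebesgue_integral circle_measure (UNIV - A) f"
      using A fi by (intro set_integral_Un)
        (auto simp: set_integrable_def intro!: integrable_mult_indicator)
    moreover have "set_lebesgue_integral circle_measure UNIV f = 0"
      using coeff_null_closed[OF f, of UNIV] by simp
    ultimately show ?case using compl(2) by simp
  next
    case (union A)
    have A: "A i \<in> sets circle_measure" for i using union(2) by (auto simp: borel_eq_closed)
    have "set_lebesgue_integral circle_measure (\<Union>i. A i) f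
        = (\<Sum>i. set_lebesgue_integral circle_measure (A i) f)"
    proof (rule lebesgue_integral_countable_add)
      show "A i \<inter> A j = {}" if "i \<noteq> j" for i j
        using union(1) that by (auto simp: disjoint_family_on_def)
      show "set_integrable circle_measure (\<Union>i. A i) f"
        unfolding set_integrable_def using A fi by (intro integrable_mult_indicator) auto
    qed (rule A)
    then show ?case using union(3) by simp
  qed
qed

section \<open>Representatives, norms and completeness of L^2\<close>

lemma L2_cases:
  obtains f where "square_integrable f" "f \<in> borel_measurable borel" "x = abs_L2 f"
proof -
  have "L2_eq (rep_L2 x) (rep_L2 x)"
    using Quotient3_rel_rep[OF Quotient3_L2, of x x] by simp
  then show ?thesis
    using that[of "rep_L2 x"]
    by (simp add: L2_eq_def square_integrable_def Quotient3_abs_rep[OF Quotient3_L2])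
qed

lemma L2_eq_refl: "square_integrable f \<Longrightarrow> L2_eq f f"
  by (simp add: L2_eq_def)

lemma abs_L2_eqI: "L2_eq f g \<Longrightarrow> abs_L2 f = abs_L2 g"
  by (rule Quotient3_rel_abs[OF Quotient3_L2])

lemma abs_L2_scaleC: "square_integrable f \<Longrightarrow> c *\<^sub>C abs_L2 f = abs_L2 (\<lambda>z. c * f z)"
  by (simp add: scaleC_L2.abs_eq L2_eq_refl)

lemma abs_L2_add:
  "square_integrable f \<Longrightarrow> square_integrable g \<Longrightarrow> abs_L2 f + abs_L2 g = abs_L2 (\<lambda>z. f z + g z)"
  by (simp add: plus_L2.abs_eq L2_eq_refl)

lemma square_integrable_diff:
  "square_integrable f \<Longrightarrow> square_integrable g \<Longrightarrow> square_integrable (\<lambda>z. f z - g z)"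
  using square_integrable_add[of f "\<lambda>z. - 1 * g z"] square_integrable_scale[of g "- 1"] by simp

lemma abs_L2_diff:
  "square_integrable f \<Longrightarrow> square_integrable g \<Longrightarrow> abs_L2 f - abs_L2 g = abs_L2 (\<lambda>z. f z - g z)"
  using square_integrable_scale[of g "- 1"]
  by (simp add: minus_L2_def uminus_L2_def abs_L2_scaleC abs_L2_add)

lemma cinner_abs_L2:
  "square_integrable f \<Longrightarrow> square_integrable g \<Longrightarrow>
    cinner (abs_L2 f) (abs_L2 g) = integral\<^sup>L circle_measure (\<lambda>z. f z * cnj (g z))"
  by (simp add: cinner_L2.abs_eq L2_eq_refl)

lemma norm_abs_L2:
  assumes "square_integrable f"
  shows "(norm (abs_L2 f))\<^sup>2 = integral\<^sup>L circle_measure (\<lambda>z. (norm (f z))\<^sup>2)"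
proof -
  have "(norm (abs_L2 f))\<^sup>2 = Re (cinner (abs_L2 f) (abs_L2 f))"
    by (simp add: power2_norm_eq_inner inner_eq_Re_cinner)
  also have "\<dots> = integral\<^sup>L circle_measure (\<lambda>z. (norm (f z))\<^sup>2)"
    unfolding cinner_abs_L2[OF assms assms]
    by (simp only: complex_norm_square[symmetric] integral_complex_of_real Re_complex_of_real)
  finally show ?thesis .
qed

text \<open>Cauchy-Schwarz against the constant 1, a unit vector because the measure has total mass
  1. It makes L^2-Cauchy sequences L^1-Cauchy.\<close>

lemma integral_norm_le_norm_L2:
  assumes f: "square_integrable f"
  shows "integral\<^sup>L circle_measure (\<lambda>z. norm (f z)) \<le> norm (abs_L2 f)"
proof -
  define g where "g z = complex_of_real (norm (f z))" for z
  have fm [measurable]: "f \<in> borel_measurable borel"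
    using f by (simp add: square_integrable_def)
  have g: "square_integrable g"
    using f by (simp add: square_integrable_def g_def[abs_def])
  have one: "square_integrable (\<lambda>_. 1)"
    using square_integrable_powi[of 0] by simp
  have "(norm (abs_L2 g))\<^sup>2 = (norm (abs_L2 f))\<^sup>2"
    by (simp add: norm_abs_L2[OF g] norm_abs_L2[OF f]) (simp add: g_def)
  then have ng: "norm (abs_L2 g) = norm (abs_L2 f)" by simp
  have "(norm (abs_L2 (\<lambda>_. 1)))\<^sup>2 = 1"
    by (simp add: norm_abs_L2[OF one] measure_circle_UNIV)
  then have n1: "norm (abs_L2 (\<lambda>_. 1)) = 1"
    using norm_ge_zero[of "abs_L2 (\<lambda>_. 1)"] by (auto simp: power2_eq_1_iff)
  have "integral\<^sup>L circle_measure (\<lambda>z. norm (f z)) = inner (abs_L2 g) (abs_L2 (\<lambda>_. 1))"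
    by (simp add: inner_eq_Re_cinner cinner_abs_L2[OF g one]) (simp add: g_def)
  also have "\<dots> \<le> norm (abs_L2 f)"
    using norm_cauchy_schwarz[of "abs_L2 g" "abs_L2 (\<lambda>_. 1)"] by (simp add: ng n1)
  finally show ?thesis .
qed

instance L2 :: complete_space
proof
  fix X :: "nat \<Rightarrow> L2"
  assume X: "Cauchy X"
  have "\<forall>n. \<exists>f. square_integrable f \<and> X n = abs_L2 f"
    by (metis L2_cases)
  then obtain s where sq: "\<And>n. square_integrable (s n)" and Xs: "\<And>n. X n = abs_L2 (s n)"
    by metis
  have sm [measurable]: "s n \<in> borel_measurable borel" for n
    using sq[of n] by (simp add: square_integrable_def)
  have diff: "X i - X j = abs_L2 (\<lambda>z. s i z - s j z)" for i j
    by (simp add: Xs abs_L2_diff sq)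
  \<comment> \<open>L^1 control already yields a subsequence converging almost everywhere; its limit
    is the candidate.\<close>
  obtain r where r: "strict_mono r" "AE z in circle_measure. Cauchy (\<lambda>i. s (r i) z)"
  proof (rule cauchy_L1_AE_cauchy_subseq)
    show "integrable circle_measure (s n)" for n
      by (rule square_integrable_imp_integrable[OF sq])
    show "\<exists>N. \<forall>i\<ge>N. \<forall>j\<ge>N. LINT z|circle_measure. norm (s i z - s j z) < e" if e: "e > 0" for e
    proof -
      obtain N where N: "\<And>i j. i \<ge> N \<Longrightarrow> j \<ge> N \<Longrightarrow> norm (X i - X j) < e"
        using CauchyD[OF X e] by blast
      then show ?thesis
        using integral_norm_le_norm_L2[OF square_integrable_diff[OF sq sq]]
        unfolding diff by (meson le_less_trans)
    qed
  qed
  define f where "f z = lim (\<lambda>i. s (r i) z)" for z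
  have fm [measurable]: "f \<in> borel_measurable borel"
    unfolding f_def by (rule borel_measurable_lim_metric) simp
  have lim: "AE z in circle_measure. (\<lambda>i. s (r i) z) \<longlonglongrightarrow> f z"
    using r(2) by eventually_elim (simp add: f_def Cauchy_convergent_iff convergent_LIMSEQ_iff)
  \<comment> \<open>Fatou's lemma along the subsequence: the estimate for
    \<open>X n - X (r i)\<close> survives the limit in \<open>i\<close>, which also puts the
    difference \<open>s n - f\<close> into L^2.\<close>
  have bound: "integrable circle_measure (\<lambda>z. (norm (s n z - f z))\<^sup>2)
      \<and> integral\<^sup>L circle_measure (\<lambda>z. (norm (s n z - f z))\<^sup>2) \<le> e\<^sup>2"
    if e: "e > 0" and N: "\<And>i j. i \<ge> N \<Longrightarrow> j \<ge> N \<Longrightarrow> norm (X i - X j) < e" and n: "n \<ge> N" for e N n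
  proof -
    have "(\<integral>\<^sup>+z. ennreal ((norm (s n z - f z))\<^sup>2) \<partial>circle_measure)
        = (\<integral>\<^sup>+z. liminf (\<lambda>i. ennreal ((norm (s n z - s (r i) z))\<^sup>2)) \<partial>circle_measure)"
    proof (rule nn_integral_cong_AE)
      show "AE z in circle_measure. ennreal ((norm (s n z - f z))\<^sup>2)
          = liminf (\<lambda>i. ennreal ((norm (s n z - s (r i) z))\<^sup>2))"
        using lim
      proof eventually_elim
        case (elim z)
        then have "(\<lambda>i. ennreal ((norm (s n z - s (r i) z))\<^sup>2)) \<longlonglongrightarrow> ennreal ((norm (s n z - f z))\<^sup>2)"
          by (intro tendsto_intros)
        from lim_imp_Liminf[OF trivial_limit_sequentially this] show ?case ..
      qed
    qed
    also have "\<dots> \<le> liminf (\<lambda>i. \<integral>\<^sup>+z. ennreal ((norm (s n z - s (r i) z))\<^sup>2) \<partial>circle_measure)"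
      by (rule nn_integral_liminf) simp
    also have "\<dots> \<le> ennreal (e\<^sup>2)"
    proof (rule Liminf_le)
      show "eventually (\<lambda>i. (\<integral>\<^sup>+z. ennreal ((norm (s n z - s (r i) z))\<^sup>2) \<partial>circle_measure) \<le> ennreal (e\<^sup>2))
          sequentially"
        using eventually_ge_at_top[of N]
      proof eventually_elim
        case (elim i)
        then have ri: "r i \<ge> N" using seq_suble[OF r(1), of i] by simp
        have "(\<integral>\<^sup>+z. ennreal ((norm (s n z - s (r i) z))\<^sup>2) \<partial>circle_measure)
            = ennreal ((norm (X n - X (r i)))\<^sup>2)"
          unfolding diff norm_abs_L2[OF square_integrable_diff[OF sq sq]]
          using square_integrable_diff[OF sq sq]
          by (intro nn_integral_eq_integral) (auto simp: square_integrable_def)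
        also have "\<dots> \<le> ennreal (e\<^sup>2)"
          using N[OF n ri] by (intro ennreal_leI power_mono) auto
        finally show ?case .
      qed
    qed simp
    finally have le: "(\<integral>\<^sup>+z. ennreal ((norm (s n z - f z))\<^sup>2) \<partial>circle_measure) \<le> ennreal (e\<^sup>2)" .
    have int: "integrable circle_measure (\<lambda>z. (norm (s n z - f z))\<^sup>2)"
      using le by (intro integrableI_bounded) (auto simp: order_le_less_trans)
    then show ?thesis
      using le by (simp add: nn_integral_eq_integral)
  qed
  \<comment> \<open>One square-integrable difference is enough: \<open>f\<close> is
    \<open>s N1\<close> minus it.\<close>
  obtain N1 where "\<And>i j. i \<ge> N1 \<Longrightarrow> j \<ge> N1 \<Longrightarrow> norm (X i - X j) < 1"
    using CauchyD[OF X, of 1] by auto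
  from bound[OF _ this order_refl] have "square_integrable (\<lambda>z. s N1 z - f z)"
    by (simp add: square_integrable_def)
  from square_integrable_diff[OF sq[of N1] this] have f: "square_integrable f" by simp
  have "X \<longlonglongrightarrow> abs_L2 f"
  proof (rule LIMSEQ_I)
    fix e :: real assume e: "e > 0"
    then have e2: "e / 2 > 0" by simp
    obtain N where N: "\<And>i j. i \<ge> N \<Longrightarrow> j \<ge> N \<Longrightarrow> norm (X i - X j) < e / 2"
      using CauchyD[OF X e2] by auto
    have "norm (X n - abs_L2 f) < e" if "n \<ge> N" for n
    proof -
      have "(norm (X n - abs_L2 f))\<^sup>2 \<le> (e / 2)\<^sup>2"
        using bound[OF e2 N that] unfolding Xs abs_L2_diff[OF sq f] norm_abs_L2[OF square_integrable_diff[OF sq f]]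
        by blast
      then have "norm (X n - abs_L2 f) \<le> e / 2"
        by (rule power2_le_imp_le) (use e in simp)
      then show ?thesis using e by simp
    qed
    then show "\<exists>N. \<forall>n\<ge>N. norm (X n - abs_L2 f) < e" by blast
  qed
  then show "convergent X" by (auto simp: convergent_def)
qed

instance L2 :: banach ..

section \<open>The monomials and their totality in L^2\<close>

definition ez :: "int \<Rightarrow> L2" where
  "ez n = abs_L2 (\<lambda>z. z powi n)"

lemma fourier_coeff_abs_L2:
  "square_integrable f \<Longrightarrow> fourier_coeff (abs_L2 f) n = integral\<^sup>L circle_measure (\<lambda>z. f z * cnj (z powi n))"
  by (simp add: fourier_coeff.abs_eq L2_eq_refl)

lemma cinner_ez: "cinner f (ez n) = fourier_coeff f n"
  by (rule L2_cases[of f])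
     (simp add: ez_def cinner_abs_L2 fourier_coeff_abs_L2 square_integrable_powi)

lemma fourier_coeff_ez: "fourier_coeff (ez m) n = (if m = n then 1 else 0)"
proof -
  have "integral\<^sup>L circle_measure (\<lambda>z. z powi m * cnj (z powi n))
      = integral\<^sup>L circle_measure (\<lambda>z. z powi (m - n))"
  proof (rule integral_cong_AE)
    show "AE z in circle_measure. z powi m * cnj (z powi n) = z powi (m - n)"
      using AE_circle_norm AE_circle_cnj_powi[of n]
    proof eventually_elim
      case (elim z)
      then have "z \<noteq> 0" by auto
      then show ?case using elim by (simp add: power_int_diff power_int_minus field_simps)
    qed
  qed simp_all
  then show ?thesis
    by (simp add: ez_def fourier_coeff_abs_L2 square_integrable_powi integral_circle_powi)
qed

lemma fourier_coeff_eq_0_imp: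
  assumes "\<And>n. fourier_coeff f n = 0"
  shows "f = 0"
proof -
  obtain g where g: "square_integrable g" "g \<in> borel_measurable borel" "f = abs_L2 g"
    by (rule L2_cases)
  note g(2) [measurable]
  have "integral\<^sup>L circle_measure (\<lambda>z. g z * z powi n) = 0" for n
  proof -
    have "integral\<^sup>L circle_measure (\<lambda>z. g z * z powi n)
        = integral\<^sup>L circle_measure (\<lambda>z. g z * cnj (z powi (- n)))"
      by (rule integral_cong_AE) (use AE_circle_cnj_powi[of "-n"] in auto)
    also have "\<dots> = 0"
      using assms[of "-n"] g by (simp add: fourier_coeff_abs_L2)
    finally show ?thesis .
  qed
  then have "coeff_null g"
    using square_integrable_imp_integrable[OF g(1)] by (simp add: coeff_null_def)
  from coeff_null_AE_zero[OF this] have "L2_eq g (\<lambda>_. 0)"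
    using g by (simp add: L2_eq_def square_integrable_0)
  then show ?thesis
    unfolding g(3) zero_L2_def map_fun_def by (simp add: abs_L2_eqI)
qed

section \<open>Orthonormal expansions and Laurent forms\<close>

lemma scaleC_one: "1 *\<^sub>C x = (x::'a::complex_inner)"
  using scaleR_scaleC[of 1 x] by simp

lemma scaleC_zero_left: "0 *\<^sub>C x = (0::'a::complex_inner)"
  using scaleR_scaleC[of 0 x] by simp

lemma scaleC_zero_right: "c *\<^sub>C 0 = (0::'a::complex_inner)"
  using scaleC_add_right[of c 0 "0::'a"] by simp

lemma cinner_zero_left: "cinner 0 (y::'a::complex_inner) = 0"
  using cinner_add_left[of 0 0 y] by simp

lemma cinner_uminus_left: "cinner (- x) (y::'a::complex_inner) = - cinner x y"
  using cinner_add_left[of x "- x" y] by (simp add: cinner_zero_left add_eq_0_iff)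

lemma cinner_diff_left: "cinner (x - y) (z::'a::complex_inner) = cinner x z - cinner y z"
  using cinner_add_left[of x "- y" z] by (simp add: cinner_uminus_left)

lemma cinner_sum_left: "cinner (\<Sum>i\<in>A. f i) (y::'a::complex_inner) = (\<Sum>i\<in>A. cinner (f i) y)"
  by (induction A rule: infinite_finite_induct) (simp_all add: cinner_zero_left cinner_add_left)

lemma cinner_zero_right: "cinner (x::'a::complex_inner) 0 = 0"
  using cinner_commute[of x 0] by (simp add: cinner_zero_left)

lemma cinner_add_right: "cinner (x::'a::complex_inner) (y + z) = cinner x y + cinner x z"
  unfolding cinner_commute[of x] by (simp add: cinner_add_left)

lemma cinner_scaleC_right: "cinner (x::'a::complex_inner) (c *\<^sub>C y) = cnj c * cinner x y"
  unfolding cinner_commute[of x] by (simp add: cinner_scaleC_left)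

lemma cinner_sum_right: "cinner (x::'a::complex_inner) (\<Sum>i\<in>A. f i) = (\<Sum>i\<in>A. cinner x (f i))"
  unfolding cinner_commute[of x] by (simp add: cinner_sum_left cnj_sum)

lemma cinner_self: "cinner x (x::'a::complex_inner) = of_real ((norm x)\<^sup>2)"
proof -
  have "Im (cinner x x) = 0"
    using arg_cong[OF cinner_commute[of x x], of Im] by simp
  then show ?thesis
    by (simp add: complex_eq_iff power2_norm_eq_inner inner_eq_Re_cinner)
qed

lemma norm_scaleC: "norm (c *\<^sub>C x) = norm c * norm (x::'a::complex_inner)"
proof -
  have "complex_of_real ((norm (c *\<^sub>C x))\<^sup>2) = of_real ((norm c * norm x)\<^sup>2)"
    unfolding cinner_self[symmetric] cinner_scaleC_left cinner_scaleC_right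
    unfolding cinner_self power_mult_distrib of_real_mult complex_norm_square by (simp add: mult.assoc)
  then have "(norm (c *\<^sub>C x))\<^sup>2 = (norm c * norm x)\<^sup>2"
    by (simp only: of_real_eq_iff)
  then show ?thesis by (simp add: power2_eq_iff_nonneg)
qed

lemma norm_cinner_le: "norm (cinner x y) \<le> norm x * norm (y::'a::complex_inner)"
proof (cases "cinner x y = 0")
  case False
  \<comment> \<open>A unimodular rotation of \<open>x\<close> makes the inner product real and
    nonnegative, so that the real Cauchy-Schwarz inequality applies.\<close>
  define c where "c = cnj (sgn (cinner x y))"
  have "norm c = 1" using False by (simp add: c_def norm_sgn)
  have "cinner (c *\<^sub>C x) y = of_real (norm (cinner x y))"
  proof -
    have "cinner (c *\<^sub>C x) y = cnj (sgn (cinner x y)) * cinner x y"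
      by (simp add: c_def cinner_scaleC_left)
    also have "\<dots> = (cinner x y * cnj (cinner x y)) / of_real (norm (cinner x y))"
      by (simp add: sgn_div_norm scaleR_conv_of_real field_simps)
    also have "\<dots> = of_real (norm (cinner x y))"
      using False by (simp add: complex_norm_square[symmetric] power2_eq_square)
    finally show ?thesis .
  qed
  then have "norm (cinner x y) = inner (c *\<^sub>C x) y"
    by (simp add: inner_eq_Re_cinner)
  also have "\<dots> \<le> norm x * norm y"
    using norm_cauchy_schwarz[of "c *\<^sub>C x" y] by (simp add: norm_scaleC \<open>norm c = 1\<close>)
  finally show ?thesis .
qed simp

lemma norm_add_sq:
  "(norm (x + y :: 'a::complex_inner))\<^sup>2 = (norm x)\<^sup>2 + 2 * Re (cinner x y) + (norm y)\<^sup>2"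
  by (simp add: power2_norm_eq_inner inner_add_left inner_add_right inner_commute inner_eq_Re_cinner[symmetric])

lemma bounded_linear_cinner_left: "bounded_linear (\<lambda>x. cinner x (y::'a::complex_inner))"
  by (rule bounded_linear_intro[where K = "norm y"])
     (simp_all add: cinner_add_left scaleR_scaleC cinner_scaleC_left scaleR_conv_of_real norm_cinner_le)

lemma bounded_linear_cinner_right: "bounded_linear (\<lambda>y. cinner (x::'a::complex_inner) y)"
  by (rule bounded_linear_intro[where K = "norm x"])
     (simp_all add: cinner_add_right scaleR_scaleC cinner_scaleC_right scaleR_conv_of_real
       norm_cinner_le mult.commute[of "norm _" "norm x"])

lemmas tendsto_cinner_left = bounded_linear.tendsto[OF bounded_linear_cinner_left]

lemma cinner_left_ext:
  assumes "\<And>z. cinner x z = cinner y (z::'a::complex_inner)"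
  shows "x = y"
proof -
  have "cinner (x - y) (x - y) = 0"
    using assms[of "x - y"] by (simp add: cinner_diff_left)
  then show ?thesis by (simp add: cinner_self)
qed

lemma bounded_clinearI:
  assumes "\<And>x y. A (x + y) = A x + A y" "\<And>c x. A (c *\<^sub>C x) = c *\<^sub>C A x"
    "\<And>x. norm (A x) \<le> K * norm x"
  shows "bounded_clinear A"
  unfolding bounded_clinear_def
proof
  show "bounded_linear A"
    by (rule bounded_linear_intro[where K = K])
       (simp_all add: assms(1,2) scaleR_scaleC, metis assms(3) mult.commute)
qed (simp add: assms(2))

context
  fixes A :: "'a::complex_inner \<Rightarrow> 'b::complex_inner"
  assumes A: "bounded_clinear A"
begin

lemma bounded_clinear_bounded_linear: "bounded_linear A"
  and bounded_clinear_scaleC: "A (c *\<^sub>C x) = c *\<^sub>C A x"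
  using A by (simp_all add: bounded_clinear_def)

lemma bounded_clinear_add: "A (x + y) = A x + A y"
  and bounded_clinear_zero: "A 0 = 0"
  and bounded_clinear_diff: "A (x - y) = A x - A y"
  and bounded_clinear_sum: "A (sum f I) = (\<Sum>i\<in>I. A (f i))"
  using bounded_linear.linear[OF bounded_clinear_bounded_linear]
  by (simp_all add: linear_add linear_0 linear_diff linear_sum)

lemma bounded_clinear_bound: "\<exists>K>0. \<forall>x. norm (A x) \<le> K * norm x"
  using bounded_linear.pos_bounded[OF bounded_clinear_bounded_linear] by (metis mult.commute)

end

lemma bounded_clinear_compose:
  "bounded_clinear A \<Longrightarrow> bounded_clinear B \<Longrightarrow> bounded_clinear (\<lambda>x. A (B x))"
  unfolding bounded_clinear_def by (auto intro: bounded_linear_compose)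

lemma cadjoint_eqI:
  assumes "\<And>x y. cinner (A x) y = cinner x (B y)"
  shows "cadjoint A = B"
  unfolding cadjoint_def
proof (rule the_equality)
  show "\<forall>x y. cinner (A x) y = cinner x (B y)" using assms by blast
  fix C assume C: "\<forall>x y. cinner (A x) y = cinner x (C y)"
  have "cinner (C y) x = cinner (B y) x" for x y
    using C assms by (metis cinner_commute)
  then show "C = B" by (blast intro: cinner_left_ext)
qed

section \<open>Orthonormal systems: Bessel, Riesz-Fischer, expansions\<close>

definition orthonormal :: "('i \<Rightarrow> 'a::complex_inner) \<Rightarrow> bool" where
  "orthonormal e \<longleftrightarrow> (\<forall>i j. cinner (e i) (e j) = (if i = j then 1 else 0))"

lemma orthonormal_cinner_sum:
  assumes "orthonormal e" "finite I"
  shows "cinner (\<Sum>i\<in>I. c i *\<^sub>C e i) (e j) = (if j \<in> I then c j else 0)"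
proof -
  have ee: "cinner (e i) (e j) = (if i = j then 1 else 0)" for i
    using assms(1) unfolding orthonormal_def by blast
  have "cinner (\<Sum>i\<in>I. c i *\<^sub>C e i) (e j) = (\<Sum>i\<in>I. if i = j then c i else 0)"
    by (simp add: cinner_sum_left cinner_scaleC_left ee if_distrib cong: if_cong)
  then show ?thesis using assms(2) by simp
qed

lemma orthonormal_norm_sum:
  assumes "orthonormal e" "finite I"
  shows "(norm (\<Sum>i\<in>I. c i *\<^sub>C e i))\<^sup>2 = (\<Sum>i\<in>I. (norm (c i))\<^sup>2)"
proof -
  have "complex_of_real ((norm (\<Sum>i\<in>I. c i *\<^sub>C e i))\<^sup>2) = (\<Sum>i\<in>I. cnj (c i) * c i)"
    unfolding cinner_self[symmetric] cinner_sum_right cinner_scaleC_right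
    using assms by (simp add: orthonormal_cinner_sum)
  also have "\<dots> = of_real (\<Sum>i\<in>I. (norm (c i))\<^sup>2)"
    by (simp only: of_real_sum complex_norm_square mult.commute)
  finally show ?thesis by (simp only: of_real_eq_iff)
qed

lemma bessel:
  assumes "orthonormal e" "finite I"
  shows "(\<Sum>i\<in>I. (norm (cinner x (e i)))\<^sup>2) \<le> (norm x)\<^sup>2"
proof -
  define g where "g = (\<Sum>i\<in>I. cinner x (e i) *\<^sub>C e i)"
  have "cinner (x - g) (e j) = 0" if "j \<in> I" for j
    unfolding g_def cinner_diff_left orthonormal_cinner_sum[OF assms] using that by simp
  then have "cinner (x - g) g = 0"
    by (subst (2) g_def) (simp add: cinner_sum_right cinner_scaleC_right)
  then have "(norm x)\<^sup>2 = (norm (x - g))\<^sup>2 + (norm g)\<^sup>2"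
    using norm_add_sq[of "x - g" g] by simp
  then show ?thesis
    using orthonormal_norm_sum[OF assms, of "\<lambda>i. cinner x (e i)"]
    by (simp add: g_def[symmetric])
qed

text \<open>Squared distances of partial sums are increments of the bounded increasing sequence
  \<open>t\<close>, so the partial sums are Cauchy. Summation along an increasing family
  \<open>I N\<close> serves both the integer windows and the initial segments of the
  naturals.\<close>

lemma riesz_fischer:
  fixes e :: "'i \<Rightarrow> 'a::{complex_inner, complete_space}"
  assumes e: "orthonormal e" and fin: "\<And>N. finite (I N)" and mono: "mono I"
    and bound: "\<And>N::nat. (\<Sum>i\<in>I N. (norm (c i))\<^sup>2) \<le> K"
  obtains x where "(\<lambda>N. \<Sum>i\<in>I N. c i *\<^sub>C e i) \<longlonglongrightarrow> x"
    and "\<And>i. i \<in> (\<Union>N. I N) \<Longrightarrow> cinner x (e i) = c i"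
proof -
  define t where "t N = (\<Sum>i\<in>I N. (norm (c i))\<^sup>2)" for N
  define s where "s N = (\<Sum>i\<in>I N. c i *\<^sub>C e i)" for N
  have I: "I M \<subseteq> I N" if "M \<le> N" for M N using mono that by (simp add: monoD)
  have "incseq t"
    unfolding t_def by (intro monoI sum_mono2 fin I) auto
  then have "convergent t"
    using bound by (intro Bseq_mono_convergent BseqI'[where K = K])
      (auto simp: t_def incseq_def abs_of_nonneg sum_nonneg)
  then have t: "Cauchy t" by (rule convergent_Cauchy)
  have st: "(norm (s N - s M))\<^sup>2 = t N - t M" if "M \<le> N" for M N
  proof -
    have "s N - s M = (\<Sum>i\<in>I N - I M. c i *\<^sub>C e i)"
      unfolding s_def using I[OF that] fin by (simp add: sum_diff)
    moreover have "t N - t M = (\<Sum>i\<in>I N - I M. (norm (c i))\<^sup>2)"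
      unfolding t_def using I[OF that] fin by (simp add: sum_diff)
    ultimately show ?thesis using orthonormal_norm_sum[OF e] fin by simp
  qed
  have "Cauchy s"
  proof (rule CauchyI)
    fix d :: real assume d: "0 < d"
    then obtain M where M: "\<And>m n. m \<ge> M \<Longrightarrow> n \<ge> M \<Longrightarrow> norm (t m - t n) < d\<^sup>2"
      using CauchyD[OF t, of "d\<^sup>2"] by auto
    have "norm (s m - s n) < d" if "m \<ge> M" "n \<ge> M" for m n
    proof -
      have "(norm (s m - s n))\<^sup>2 < d\<^sup>2"
      proof (cases "n \<le> m")
        case True
        then show ?thesis using st[OF True] M[OF that] by simp
      next
        case False
        then show ?thesis using st[of m n] M[OF that] by (simp add: norm_minus_commute)
      qed
      then show ?thesis using d by (simp add: power2_less_imp_less)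
    qed
    then show "\<exists>M. \<forall>m\<ge>M. \<forall>n\<ge>M. norm (s m - s n) < d" by blast
  qed
  then obtain x where x: "s \<longlonglongrightarrow> x" unfolding Cauchy_convergent_iff convergent_def by blast
  have "cinner x (e i) = c i" if i: "i \<in> (\<Union>N. I N)" for i
  proof -
    obtain M where M: "i \<in> I M" using i by blast
    have "(\<lambda>N. cinner (s N) (e i)) \<longlonglongrightarrow> cinner x (e i)"
      by (rule tendsto_cinner_left[OF x])
    moreover have "eventually (\<lambda>N. cinner (s N) (e i) = c i) sequentially"
      using eventually_ge_at_top[of M]
      by eventually_elim (use I M in \<open>auto simp: s_def orthonormal_cinner_sum[OF e fin]\<close>)
    ultimately show ?thesis
      by (rule LIMSEQ_unique[OF _ tendsto_eventually])
  qed
  with x show ?thesis unfolding s_def by (rule that)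
qed

lemma orthonormal_expansion:
  fixes e :: "'i \<Rightarrow> 'a::{complex_inner, complete_space}"
  assumes e: "orthonormal e" and fin: "\<And>N::nat. finite (I N)" and mono: "mono I"
    and UN: "(\<Union>N. I N) = UNIV" and total: "\<And>x. (\<And>i. cinner x (e i) = 0) \<Longrightarrow> x = 0"
  shows "(\<lambda>N. \<Sum>i\<in>I N. cinner x (e i) *\<^sub>C e i) \<longlonglongrightarrow> x"
proof -
  obtain y where y: "(\<lambda>N. \<Sum>i\<in>I N. cinner x (e i) *\<^sub>C e i) \<longlonglongrightarrow> y"
    and c: "\<And>i. i \<in> (\<Union>N. I N) \<Longrightarrow> cinner y (e i) = cinner x (e i)"
    using riesz_fischer[OF e fin mono bessel[OF e fin]] by blast
  have "y - x = 0" by (rule total) (simp add: cinner_diff_left c UN)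
  then show ?thesis using y by simp
qed

section \<open>Fourier series on the circle and bounded Laurent forms\<close>

definition freq_window :: "nat \<Rightarrow> int set" where "freq_window N = {- int N..int N}"

lemma finite_freq_window: "finite (freq_window N)" by (simp add: freq_window_def)

lemma mono_freq_window: "mono freq_window" by (auto simp: mono_def freq_window_def)

lemma UN_freq_window: "(\<Union>N. freq_window N) = UNIV"
proof -
  have "i \<in> freq_window (nat \<bar>i\<bar>)" for i by (auto simp: freq_window_def)
  then show ?thesis by blast
qed

lemma orthonormal_ez: "orthonormal ez"
  by (simp add: orthonormal_def cinner_ez fourier_coeff_ez)

lemma L2_expansion: "(\<lambda>N. \<Sum>i\<in>freq_window N. fourier_coeff f i *\<^sub>C ez i) \<longlonglongrightarrow> f"
  using orthonormal_expansion[OF orthonormal_ez finite_freq_window mono_freq_window UN_freq_window, of f]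
  by (simp add: cinner_ez fourier_coeff_eq_0_imp)

lemma L2_riesz_fischer:
  assumes "\<And>N. (\<Sum>i\<in>freq_window N. (norm (c i))\<^sup>2) \<le> K"
  obtains f where "\<And>i. fourier_coeff f i = c i"
  using riesz_fischer[OF orthonormal_ez finite_freq_window mono_freq_window assms] by (auto simp: UN_freq_window cinner_ez)

lemma fourier_coeff_diff: "fourier_coeff (f - g) n = fourier_coeff f n - fourier_coeff g n"
  by (simp add: cinner_ez[symmetric] cinner_diff_left)

lemma L2_eqI: "(\<And>n. fourier_coeff f n = fourier_coeff g n) \<Longrightarrow> f = g"
  using fourier_coeff_eq_0_imp[of "f - g"] by (simp add: fourier_coeff_diff)

text \<open>For sums \<open>T\<close> of squares: testing a functional of bound \<open>D\<close> on
  its own coefficients gives \<open>T \<le> D * sqrt T\<close>, and this removes the root.\<close>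

lemma le_mult_sqrt_imp:
  assumes "0 \<le> T" "T \<le> D * sqrt T" "0 \<le> D"
  shows "T \<le> D\<^sup>2"
proof (cases "T = 0")
  case False
  then have pos: "sqrt T > 0" using assms(1) by simp
  have "sqrt T * sqrt T \<le> D * sqrt T" using assms by simp
  then have "sqrt T \<le> D" using pos by (simp only: mult_le_cancel_right_pos)
  then have "(sqrt T)\<^sup>2 \<le> D\<^sup>2" using pos by (intro power_mono) auto
  then show ?thesis using assms(1) by simp
qed simp

lemma ess_bounded_abs_L2:
  "square_integrable f \<Longrightarrow> ess_bounded (abs_L2 f) \<longleftrightarrow> (\<exists>C::real. AE z in circle_measure. norm (f z) \<le> C)"
  by (simp add: ess_bounded.abs_eq L2_eq_refl)

text \<open>Column 0 of the form is square summable, which gives an L^2 function with representative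
  \<open>u\<close>. The form then says that multiplication by \<open>u\<close> has norm at most
  \<open>C\<close>; on the indicator of the set where \<open>norm (u z)\<close> exceeds
  \<open>C\<close> this is impossible unless the set is null.\<close>

lemma laurent_form_imp_Linf:
  assumes C: "0 \<le> C" and form: "\<And>N p q. norm (\<Sum>i\<in>freq_window N. \<Sum>j\<in>freq_window N. g (j - i) * p i * cnj (q j))
    \<le> C * sqrt (\<Sum>i\<in>freq_window N. (norm (p i))\<^sup>2) * sqrt (\<Sum>j\<in>freq_window N. (norm (q j))\<^sup>2)"
  shows "\<exists>\<psi>\<in>Linf. \<forall>n. fourier_coeff \<psi> n = g n"
proof -
  \<comment> \<open>Test vectors: the unit vector at 0 against \<open>g\<close> itself.\<close>
  have "(\<Sum>j\<in>freq_window N. (norm (g j))\<^sup>2) \<le> C\<^sup>2" for N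
  proof (rule le_mult_sqrt_imp[OF _ _ C])
    let ?p = "\<lambda>i::int. if i = 0 then 1 else 0 :: complex"
    have Z0: "0 \<in> freq_window N" by (simp add: freq_window_def)
    have "(\<Sum>i\<in>freq_window N. \<Sum>j\<in>freq_window N. g (j - i) * ?p i * cnj (g j))
        = (\<Sum>i\<in>freq_window N. if i = 0 then \<Sum>j\<in>freq_window N. g j * cnj (g j) else 0)"
      by (intro sum.cong refl) auto
    also have "\<dots> = of_real (\<Sum>j\<in>freq_window N. (norm (g j))\<^sup>2)"
      using Z0 finite_freq_window[of N] by (simp add: complex_norm_square del: of_real_power)
    finally have "norm (\<Sum>i\<in>freq_window N. \<Sum>j\<in>freq_window N. g (j - i) * ?p i * cnj (g j))
        = (\<Sum>j\<in>freq_window N. (norm (g j))\<^sup>2)"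
      by (simp only: norm_of_real abs_of_nonneg sum_nonneg zero_le_power2)
    moreover have "(\<Sum>i\<in>freq_window N. (norm (?p i))\<^sup>2) = (\<Sum>i\<in>freq_window N. if i = 0 then 1 else 0)"
      by (intro sum.cong) auto
    moreover have "\<dots> = (1::real)" using Z0 finite_freq_window[of N] by simp
    ultimately show "(\<Sum>j\<in>freq_window N. (norm (g j))\<^sup>2) \<le> C * sqrt (\<Sum>j\<in>freq_window N. (norm (g j))\<^sup>2)"
      using form[where N = N and p = ?p and q = g] by simp
  qed (simp add: sum_nonneg)
  then obtain \<psi> where coeff: "\<And>n. fourier_coeff \<psi> n = g n"
    using L2_riesz_fischer by blast
  obtain u where u: "square_integrable u" "u \<in> borel_measurable borel" "\<psi> = abs_L2 u"
    by (rule L2_cases)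
  note u(2) [measurable]
  \<comment> \<open>Testing against \<open>v j\<close> gives the \<open>j\<close>-th coefficient of \<open>f u\<close> as an \<open>L\<^sup>2\<close>-continuous functional of \<open>f\<close>,
    although \<open>u\<close> is not yet known to be bounded.\<close>
  define v where "v j z = cnj (u z) * z powi j" for j :: int and z
  have vm [measurable]: "v j \<in> borel_measurable borel" for j
    unfolding v_def by simp
  have vsq: "square_integrable (v j)" for j
  proof -
    have "AE z in circle_measure. (norm (u z))\<^sup>2 = (norm (v j z))\<^sup>2"
      using AE_circle_norm by eventually_elim (simp add: v_def norm_mult norm_power_int)
    then have "integrable circle_measure (\<lambda>z. (norm (u z))\<^sup>2)
        \<longleftrightarrow> integrable circle_measure (\<lambda>z. (norm (v j z))\<^sup>2)"
      by (intro integrable_cong_AE) simp_all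
    then have "integrable circle_measure (\<lambda>z. (norm (v j z))\<^sup>2)"
      using u(1) by (simp add: square_integrable_def)
    then show ?thesis by (simp add: square_integrable_def)
  qed
  have cv: "cinner (abs_L2 f) (abs_L2 (v j)) = integral\<^sup>L circle_measure (\<lambda>z. f z * u z * cnj (z powi j))"
    if "square_integrable f" for f j
    using that by (simp add: cinner_abs_L2 vsq) (simp add: v_def mult.assoc)
  have ck: "cinner (ez i) (abs_L2 (v j)) = g (j - i)" for i j
  proof -
    have "cinner (ez i) (abs_L2 (v j)) = integral\<^sup>L circle_measure (\<lambda>z. z powi i * u z * cnj (z powi j))"
      unfolding ez_def by (rule cv[OF square_integrable_powi])
    also have "\<dots> = integral\<^sup>L circle_measure (\<lambda>z. u z * cnj (z powi (j - i)))"
    proof (rule integral_cong_AE)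
      show "AE z in circle_measure. z powi i * u z * cnj (z powi j) = u z * cnj (z powi (j - i))"
        using AE_circle_norm AE_circle_cnj_powi[of j] AE_circle_cnj_powi[of "j - i"]
      proof eventually_elim
        case (elim z)
        then have "z \<noteq> 0" by auto
        then show ?case using elim by (simp add: power_int_diff power_int_minus field_simps)
      qed
    qed simp_all
    also have "\<dots> = g (j - i)"
      using coeff[of "j - i"] u by (simp add: fourier_coeff_abs_L2)
    finally show ?thesis .
  qed
  \<comment> \<open>With \<open>q\<close> fixed the left side is continuous in \<open>x\<close>, so
    the bound passes from trigonometric polynomials to all of L^2; the indicator used below need not
    be a polynomial.\<close>
  have form_ext: "norm (\<Sum>j\<in>freq_window N. cinner x (abs_L2 (v j)) * cnj (q j))
      \<le> C * norm x * sqrt (\<Sum>j\<in>freq_window N. (norm (q j))\<^sup>2)" for x q N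
  proof (rule LIMSEQ_le_const2)
    define s where "s M = (\<Sum>i\<in>freq_window M. fourier_coeff x i *\<^sub>C ez i)" for M
    have "s \<longlonglongrightarrow> x" unfolding s_def by (rule L2_expansion)
    then show "(\<lambda>M. norm (\<Sum>j\<in>freq_window N. cinner (s M) (abs_L2 (v j)) * cnj (q j)))
        \<longlonglongrightarrow> norm (\<Sum>j\<in>freq_window N. cinner x (abs_L2 (v j)) * cnj (q j))"
      by (intro tendsto_intros tendsto_cinner_left)
    have "norm (\<Sum>j\<in>freq_window N. cinner (s M) (abs_L2 (v j)) * cnj (q j))
        \<le> C * norm x * sqrt (\<Sum>j\<in>freq_window N. (norm (q j))\<^sup>2)" if "M \<ge> N" for M
    proof -
      have NM: "freq_window N \<subseteq> freq_window M" using mono_freq_window that by (rule monoD)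
      \<comment> \<open>The hypothesis has one window for both vectors, so \<open>q\<close> is
        padded by 0 up to the window of \<open>s M\<close>.\<close>
      define q' where "q' j = (if j \<in> freq_window N then q j else 0)" for j
      have "(\<Sum>j\<in>freq_window N. cinner (s M) (abs_L2 (v j)) * cnj (q j))
          = (\<Sum>j\<in>freq_window M. cinner (s M) (abs_L2 (v j)) * cnj (q' j))"
        using NM finite_freq_window by (intro sum.mono_neutral_cong_left) (auto simp: q'_def)
      also have "\<dots> = (\<Sum>j\<in>freq_window M. \<Sum>i\<in>freq_window M. g (j - i) * fourier_coeff x i * cnj (q' j))"
        by (simp add: s_def cinner_sum_left cinner_scaleC_left ck sum_distrib_right sum_distrib_left mult_ac)
      also have "\<dots> = (\<Sum>i\<in>freq_window M. \<Sum>j\<in>freq_window M. g (j - i) * fourier_coeff x i * cnj (q' j))"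
        by (rule sum.swap)
      also have "norm \<dots> \<le> C * sqrt (\<Sum>i\<in>freq_window M. (norm (fourier_coeff x i))\<^sup>2) * sqrt (\<Sum>j\<in>freq_window M. (norm (q' j))\<^sup>2)"
        by (rule form)
      also have "(\<Sum>j\<in>freq_window M. (norm (q' j))\<^sup>2) = (\<Sum>j\<in>freq_window N. (norm (q j))\<^sup>2)"
        using NM finite_freq_window by (intro sum.mono_neutral_cong_right) (auto simp: q'_def)
      also have "C * sqrt (\<Sum>i\<in>freq_window M. (norm (fourier_coeff x i))\<^sup>2) * sqrt (\<Sum>j\<in>freq_window N. (norm (q j))\<^sup>2)
          \<le> C * norm x * sqrt (\<Sum>j\<in>freq_window N. (norm (q j))\<^sup>2)"
        using bessel[OF orthonormal_ez finite_freq_window, of x M] C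
        by (intro mult_right_mono mult_left_mono) (auto simp: cinner_ez sum_nonneg intro: real_le_lsqrt)
      finally show ?thesis .
    qed
    then show "\<exists>K. \<forall>M\<ge>K. norm (\<Sum>j\<in>freq_window N. cinner (s M) (abs_L2 (v j)) * cnj (q j))
        \<le> C * norm x * sqrt (\<Sum>j\<in>freq_window N. (norm (q j))\<^sup>2)" by blast
  qed
  \<comment> \<open>The set to be shown null. Although \<open>u\<close> may be unbounded on it,
    \<open>h = f u\<close> is in L^2, being dominated by \<open>u\<close>, and the functionals
    \<open>v j\<close> give its coefficients.\<close>
  define A where "A = {z. C < norm (u z)}"
  define f where "f z = complex_of_real (indicator A z)" for z
  have Am [measurable]: "A \<in> sets borel" unfolding A_def by measurable
  have fm [measurable]: "f \<in> borel_measurable borel" unfolding f_def by measurable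
  have fsq: "square_integrable f"
    by (rule square_integrable_bounded[OF fm, of 1]) (auto simp: f_def indicator_def)
  define h where "h z = f z * u z" for z
  have hm [measurable]: "h \<in> borel_measurable borel" unfolding h_def by measurable
  have hsq: "square_integrable h"
  proof -
    have "integrable circle_measure (\<lambda>z. (norm (h z))\<^sup>2)"
      by (rule Bochner_Integration.integrable_bound[of _ "\<lambda>z. (norm (u z))\<^sup>2"])
        (use u(1) in \<open>auto simp: square_integrable_def h_def f_def indicator_def\<close>)
    then show ?thesis by (simp add: square_integrable_def)
  qed
  define x where "x = abs_L2 f"
  define y where "y = abs_L2 h"
  have yx: "fourier_coeff y j = cinner x (abs_L2 (v j))" for j
    by (simp add: x_def y_def cv fsq hsq fourier_coeff_abs_L2) (simp add: h_def)
  have "(norm y)\<^sup>2 \<le> (C * norm x)\<^sup>2"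
  proof (rule LIMSEQ_le_const2)
    show "(\<lambda>N. (norm (\<Sum>i\<in>freq_window N. fourier_coeff y i *\<^sub>C ez i))\<^sup>2) \<longlonglongrightarrow> (norm y)\<^sup>2"
      by (intro tendsto_intros L2_expansion)
    have "(norm (\<Sum>i\<in>freq_window N. fourier_coeff y i *\<^sub>C ez i))\<^sup>2 \<le> (C * norm x)\<^sup>2" for N
      unfolding orthonormal_norm_sum[OF orthonormal_ez finite_freq_window]
    proof (rule le_mult_sqrt_imp)
      have "complex_of_real (\<Sum>j\<in>freq_window N. (norm (fourier_coeff y j))\<^sup>2)
         = (\<Sum>j\<in>freq_window N. cinner x (abs_L2 (v j)) * cnj (fourier_coeff y j))"
        by (simp only: of_real_sum complex_norm_square yx)
      then have "norm (complex_of_real (\<Sum>j\<in>freq_window N. (norm (fourier_coeff y j))\<^sup>2))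
         \<le> C * norm x * sqrt (\<Sum>j\<in>freq_window N. (norm (fourier_coeff y j))\<^sup>2)"
        using form_ext[where q = "fourier_coeff y"] by simp
      then show "(\<Sum>j\<in>freq_window N. (norm (fourier_coeff y j))\<^sup>2)
         \<le> C * norm x * sqrt (\<Sum>j\<in>freq_window N. (norm (fourier_coeff y j))\<^sup>2)"
        by (simp only: norm_of_real)
    qed (use C in \<open>auto simp: sum_nonneg\<close>)
    then show "\<exists>N. \<forall>n\<ge>N. (norm (\<Sum>i\<in>freq_window n. fourier_coeff y i *\<^sub>C ez i))\<^sup>2 \<le> (C * norm x)\<^sup>2" by blast
  qed
  then have "integral\<^sup>L circle_measure (\<lambda>z. (norm (h z))\<^sup>2)
      \<le> C\<^sup>2 * integral\<^sup>L circle_measure (\<lambda>z. (norm (f z))\<^sup>2)"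
    by (simp only: x_def y_def norm_abs_L2 fsq hsq power_mult_distrib)
  moreover have hi: "integrable circle_measure (\<lambda>z. (norm (h z))\<^sup>2)"
    and fi: "integrable circle_measure (\<lambda>z. (norm (f z))\<^sup>2)"
    using hsq fsq by (auto simp: square_integrable_def)
  ultimately have le0: "integral\<^sup>L circle_measure (\<lambda>z. (norm (h z))\<^sup>2 - C\<^sup>2 * (norm (f z))\<^sup>2) \<le> 0"
    by simp
  \<comment> \<open>By the choice of \<open>A\<close> the integrand is nonnegative everywhere and
    positive on \<open>A\<close>; an integral of at most 0 makes it vanish almost
    everywhere.\<close>
  have nonneg: "0 \<le> (norm (h z))\<^sup>2 - C\<^sup>2 * (norm (f z))\<^sup>2" for z
    using C by (auto simp: h_def f_def A_def indicator_def intro!: power_mono)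
  have "integral\<^sup>L circle_measure (\<lambda>z. (norm (h z))\<^sup>2 - C\<^sup>2 * (norm (f z))\<^sup>2) = 0"
    using le0 nonneg by (intro antisym) (auto intro: Bochner_Integration.integral_nonneg)
  then have "AE z in circle_measure. (norm (h z))\<^sup>2 - C\<^sup>2 * (norm (f z))\<^sup>2 = 0"
    using hi fi nonneg by (subst (asm) integral_nonneg_eq_0_iff_AE) auto
  then have "AE z in circle_measure. norm (u z) \<le> C"
  proof eventually_elim
    case (elim z)
    show ?case
    proof (rule ccontr)
      assume "\<not> norm (u z) \<le> C"
      then have "C < norm (u z)" by simp
      moreover from this have "(norm (u z))\<^sup>2 = C\<^sup>2"
        using elim by (simp add: h_def f_def A_def)
      ultimately show False using C by (simp add: power2_eq_iff)
    qed
  qed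
  then have "\<psi> \<in> Linf"
    using u by (auto simp: Linf_def ess_bounded_abs_L2)
  then show ?thesis using coeff by blast
qed

section \<open>Operators on the Hardy space and their matrices\<close>

lemma mult_L2_bounded_clinear:
  assumes "\<phi> \<in> Linf"
  shows "bounded_clinear (mult_L2 \<phi>)"
proof -
  obtain u where u: "square_integrable u" "u \<in> borel_measurable borel" "\<phi> = abs_L2 u"
    by (rule L2_cases)
  note u(2) [measurable]
  have eb: "ess_bounded (abs_L2 u)" using assms u by (simp add: Linf_def)
  then obtain C where C: "AE z in circle_measure. norm (u z) \<le> C"
    using u by (auto simp: ess_bounded_abs_L2)
  note m = mult_L2_abs[OF u(1) _ eb]
  show ?thesis
  proof (rule bounded_clinearI)
    show "mult_L2 \<phi> (x + y) = mult_L2 \<phi> x + mult_L2 \<phi> y" for x y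
      by (rule L2_cases[of x], rule L2_cases[of y])
         (simp add: u m abs_L2_add square_integrable_add distrib_left)
    show "mult_L2 \<phi> (c *\<^sub>C x) = c *\<^sub>C mult_L2 \<phi> x" for c x
      by (rule L2_cases[of x])
         (simp add: u m abs_L2_scaleC square_integrable_scale mult.left_commute)
    show "norm (mult_L2 \<phi> x) \<le> \<bar>C\<bar> * norm x" for x
    proof (rule L2_cases[of x])
      fix f assume f: "square_integrable f" "f \<in> borel_measurable borel" "x = abs_L2 f"
      note f(2) [measurable]
      have "(norm (mult_L2 \<phi> x))\<^sup>2 = integral\<^sup>L circle_measure (\<lambda>z. (norm (u z * f z))\<^sup>2)"
        by (simp only: f u m norm_abs_L2)
      also have "\<dots> \<le> integral\<^sup>L circle_measure (\<lambda>z. C\<^sup>2 * (norm (f z))\<^sup>2)"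
      proof (rule integral_mono_AE)
        show "integrable circle_measure (\<lambda>z. (norm (u z * f z))\<^sup>2)"
          using m(1)[OF f(1)] by (simp add: square_integrable_def)
        show "integrable circle_measure (\<lambda>z. C\<^sup>2 * (norm (f z))\<^sup>2)"
          using f(1) by (simp add: square_integrable_def)
        show "AE z in circle_measure. (norm (u z * f z))\<^sup>2 \<le> C\<^sup>2 * (norm (f z))\<^sup>2"
          using C by eventually_elim
            (auto simp: norm_mult power_mult_distrib intro!: mult_right_mono power_mono)
      qed
      also have "\<dots> = (\<bar>C\<bar> * norm x)\<^sup>2"
        by (simp add: f norm_abs_L2 power_mult_distrib)
      finally show "norm (mult_L2 \<phi> x) \<le> \<bar>C\<bar> * norm x"
        by (rule power2_le_imp_le) simp
    qed
  qed
qed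

text \<open>The Laurent matrix of a multiplication operator: on the circle
  \<open>z powi i * cnj (z powi j)\<close> depends on \<open>j - i\<close> only.\<close>

lemma fourier_coeff_mult_ez:
  assumes "\<phi> \<in> Linf"
  shows "fourier_coeff (mult_L2 \<phi> (ez i)) j = fourier_coeff \<phi> (j - i)"
proof -
  obtain u where u: "square_integrable u" "u \<in> borel_measurable borel" "\<phi> = abs_L2 u"
    by (rule L2_cases)
  note u(2) [measurable]
  have eb: "ess_bounded (abs_L2 u)" using assms u by (simp add: Linf_def)
  note m = mult_L2_abs[OF u(1) square_integrable_powi eb]
  have "integral\<^sup>L circle_measure (\<lambda>z. u z * z powi i * cnj (z powi j))
      = integral\<^sup>L circle_measure (\<lambda>z. u z * cnj (z powi (j - i)))"
  proof (rule integral_cong_AE)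
    show "AE z in circle_measure. u z * z powi i * cnj (z powi j) = u z * cnj (z powi (j - i))"
      using AE_circle_norm AE_circle_cnj_powi[of j] AE_circle_cnj_powi[of "j - i"]
    proof eventually_elim
      case (elim z)
      then have "z \<noteq> 0" by auto
      then show ?case using elim by (simp add: power_int_diff power_int_minus field_simps)
    qed
  qed simp_all
  then show ?thesis by (simp add: u ez_def m fourier_coeff_abs_L2)
qed

lemma flip_abs_L2:
  assumes "square_integrable f"
  shows "square_integrable (\<lambda>z. cnj z * f (cnj z))"
    and "flip_L2 (abs_L2 f) = abs_L2 (\<lambda>z. cnj z * f (cnj z))"
proof -
  show "flip_L2 (abs_L2 f) = abs_L2 (\<lambda>z. cnj z * f (cnj z))"
    by (rule flip_L2.abs_eq[OF L2_eq_refl[OF assms]])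
  have fm [measurable]: "f \<in> borel_measurable borel"
    using assms by (simp add: square_integrable_def)
  have cnj_m: "cnj \<in> borel_measurable circle_measure" by simp
  have "integrable (distr circle_measure borel cnj) (\<lambda>z. (norm (f z))\<^sup>2)"
    using assms by (simp add: circle_measure_cnj square_integrable_def)
  then have "integrable circle_measure (\<lambda>z. (norm (f (cnj z)))\<^sup>2)"
    by (subst (asm) integrable_distr_eq[OF cnj_m]) auto
  moreover have "AE z in circle_measure. (norm (f (cnj z)))\<^sup>2 = (norm (cnj z * f (cnj z)))\<^sup>2"
    using AE_circle_norm by eventually_elim (simp add: norm_mult)
  ultimately have "integrable circle_measure (\<lambda>z. (norm (cnj z * f (cnj z)))\<^sup>2)"
    by (subst (asm) integrable_cong_AE) auto
  then show "square_integrable (\<lambda>z. cnj z * f (cnj z))"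
    by (simp add: square_integrable_def)
qed

lemma integral_circle_cnj:
  fixes f :: "complex \<Rightarrow> 'a::{banach, second_countable_topology}"
  assumes [measurable]: "f \<in> borel_measurable borel"
  shows "integral\<^sup>L circle_measure (\<lambda>z. f (cnj z)) = integral\<^sup>L circle_measure f"
proof -
  have "integral\<^sup>L (distr circle_measure borel cnj) f = integral\<^sup>L circle_measure (\<lambda>z. f (cnj z))"
    by (rule integral_distr) simp_all
  then show ?thesis by (simp add: circle_measure_cnj)
qed

lemma flip_L2_bounded_clinear: "bounded_clinear flip_L2"
proof (rule bounded_clinearI)
  show "flip_L2 (x + y) = flip_L2 x + flip_L2 y" for x y
    by (rule L2_cases[of x], rule L2_cases[of y])
       (simp add: flip_abs_L2 abs_L2_add square_integrable_add distrib_left)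
  show "flip_L2 (c *\<^sub>C x) = c *\<^sub>C flip_L2 x" for c x
    by (rule L2_cases[of x])
       (simp add: flip_abs_L2 abs_L2_scaleC square_integrable_scale mult.left_commute)
  show "norm (flip_L2 x) \<le> 1 * norm x" for x
  proof (rule L2_cases[of x])
    fix f assume f: "square_integrable f" "f \<in> borel_measurable borel" "x = abs_L2 f"
    note f(2) [measurable]
    have "(norm (flip_L2 x))\<^sup>2 = integral\<^sup>L circle_measure (\<lambda>z. (norm (cnj z * f (cnj z)))\<^sup>2)"
      by (simp only: f flip_abs_L2 norm_abs_L2)
    also have "\<dots> = integral\<^sup>L circle_measure (\<lambda>z. (norm (f (cnj z)))\<^sup>2)"
      by (rule integral_cong_AE)
        (use AE_circle_norm in \<open>auto simp: norm_mult elim: eventually_mono\<close>)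
    also have "\<dots> = integral\<^sup>L circle_measure (\<lambda>z. (norm (f z))\<^sup>2)"
      by (rule integral_circle_cnj) simp
    also have "\<dots> = (norm x)\<^sup>2"
      by (simp only: f norm_abs_L2)
    finally show "norm (flip_L2 x) \<le> 1 * norm x"
      by (simp add: power2_eq_iff_nonneg)
  qed
qed

text \<open>Substitute \<open>w = cnj z\<close>, which preserves the measure. The flip exchanges the
  nonnegative with the negative frequencies; the factor \<open>cnj z\<close> causes the offset 1 in
  Hankel matrices.\<close>

lemma fourier_coeff_flip: "fourier_coeff (flip_L2 f) n = fourier_coeff f (- n - 1)"
proof (rule L2_cases[of f])
  fix u assume u: "square_integrable u" "u \<in> borel_measurable borel" "f = abs_L2 u"
  note u(2) [measurable]
  have "fourier_coeff (flip_L2 f) n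
      = integral\<^sup>L circle_measure (\<lambda>z. cnj z * u (cnj z) * cnj (z powi n))"
    by (simp add: u flip_abs_L2 fourier_coeff_abs_L2)
  also have "\<dots> = integral\<^sup>L circle_measure (\<lambda>z. (\<lambda>w. w * u w * w powi n) (cnj z))"
    by simp
  also have "\<dots> = integral\<^sup>L circle_measure (\<lambda>w. w * u w * w powi n)"
    by (rule integral_circle_cnj) simp
  also have "\<dots> = integral\<^sup>L circle_measure (\<lambda>w. u w * cnj (w powi (- n - 1)))"
  proof (rule integral_cong_AE)
    show "AE w in circle_measure. w * u w * w powi n = u w * cnj (w powi (- n - 1))"
      using AE_circle_norm AE_circle_cnj_powi[of "- n - 1"]
    proof eventually_elim
      case (elim z)
      then have "z \<noteq> 0" by auto
      then show ?case using elim by (simp add: power_int_add field_simps)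
    qed
  qed simp_all
  finally show ?thesis using u by (simp add: fourier_coeff_abs_L2)
qed

section \<open>H^2 as a complete space with its monomial basis, and operators on it\<close>

lemma H2_coeff_neg: "n < 0 \<Longrightarrow> fourier_coeff (H2_to_L2 h) n = 0"
  using H2_to_L2[of h] by (simp add: H2_set_def)

lemma H2_to_L2_bounded_clinear: "bounded_clinear H2_to_L2"
  by (rule bounded_clinearI[where K = 1])
     (simp_all add: plus_H2.rep_eq scaleC_H2.rep_eq norm_H2.rep_eq)

text \<open>H^2 is closed in L^2, since each negative Fourier coefficient is a continuous
  functional.\<close>

instance H2 :: complete_space
proof
  fix X :: "nat \<Rightarrow> H2"
  assume X: "Cauchy X"
  have "Cauchy (\<lambda>n. H2_to_L2 (X n))"
    using X by (simp add: Cauchy_def dist_norm minus_H2.rep_eq[symmetric] norm_H2.rep_eq[symmetric])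
  then obtain f where f: "(\<lambda>n. H2_to_L2 (X n)) \<longlonglongrightarrow> f"
    unfolding Cauchy_convergent_iff convergent_def by blast
  have "f \<in> H2_set"
    unfolding H2_set_def
  proof (intro CollectI allI impI)
    fix n :: int assume "n < 0"
    then show "fourier_coeff f n = 0"
      using tendsto_cinner_left[OF f, of "ez n"]
      by (simp add: cinner_ez H2_coeff_neg LIMSEQ_const_iff)
  qed
  then have f_eq: "H2_to_L2 (Abs_H2 f) = f" by (rule Abs_H2_inverse)
  have "X \<longlonglongrightarrow> Abs_H2 f"
    using f by (simp add: lim_sequentially dist_norm norm_H2.rep_eq minus_H2.rep_eq f_eq)
  then show "convergent X" by (auto simp: convergent_def)
qed

definition eh :: "nat \<Rightarrow> H2" where "eh n = Abs_H2 (ez (int n))"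

lemma H2_to_L2_eh: "H2_to_L2 (eh n) = ez (int n)"
  by (simp add: eh_def Abs_H2_inverse H2_set_def fourier_coeff_ez)

lemma cinner_eh: "cinner h (eh n) = fourier_coeff (H2_to_L2 h) (int n)"
  by (simp add: cinner_H2.rep_eq H2_to_L2_eh cinner_ez)

lemma orthonormal_eh: "orthonormal eh"
  by (simp add: orthonormal_def cinner_eh H2_to_L2_eh fourier_coeff_ez)

lemma cinner_eh_eh: "cinner (eh i) (eh j) = (if i = j then 1 else 0)"
  using orthonormal_eh by (simp add: orthonormal_def)

lemma H2_eqI:
  assumes "\<And>n. cinner x (eh n) = cinner y (eh n)"
  shows "x = y"
proof -
  have "fourier_coeff (H2_to_L2 x) n = fourier_coeff (H2_to_L2 y) n" for n
    using assms[of "nat n"] by (cases "n < 0") (simp_all add: cinner_eh H2_coeff_neg)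
  then have "H2_to_L2 x = H2_to_L2 y" by (rule L2_eqI)
  then show ?thesis by (simp add: H2_to_L2_inject)
qed

lemma H2_expansion: "(\<lambda>N. \<Sum>i<N. cinner x (eh i) *\<^sub>C eh i) \<longlonglongrightarrow> x"
proof (rule orthonormal_expansion[OF orthonormal_eh])
  show "x = 0" if "\<And>i. cinner x (eh i) = 0" for x
    using H2_eqI[of x 0] that by (simp add: cinner_zero_left)
qed (auto simp: mono_def)

lemma H2_riesz_fischer:
  assumes "\<And>N. (\<Sum>i<N. (norm (c i))\<^sup>2) \<le> K"
  obtains f where "\<And>i. cinner f (eh i) = c i"
proof (rule riesz_fischer[where I = lessThan and c = c and K = K, OF orthonormal_eh])
  have "(\<Union>N. {..<N}) = (UNIV :: nat set)" by auto
  then show thesis if "\<And>i. i \<in> (\<Union>N. {..<N}) \<Longrightarrow> cinner f (eh i) = c i" for f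
    using \<open>\<And>f. (\<And>i. cinner f (eh i) = c i) \<Longrightarrow> thesis\<close> that by blast
qed (use assms in \<open>auto simp: mono_def\<close>)

text \<open>Continuity and the density of polynomials; this reduces operator identities to
  identities of matrix entries.\<close>

lemma H2_operator_eqI:
  assumes A: "bounded_clinear A" and B: "bounded_clinear B"
    and eq: "\<And>i j. cinner (A (eh i)) (eh j) = cinner (B (eh i)) (eh j)"
  shows "A = (B :: H2 \<Rightarrow> H2)"
proof
  fix x
  have e: "A (eh i) = B (eh i)" for i by (rule H2_eqI) (rule eq)
  have "(\<lambda>N. A (\<Sum>i<N. cinner x (eh i) *\<^sub>C eh i)) \<longlonglongrightarrow> A x"
    by (rule bounded_linear.tendsto[OF bounded_clinear_bounded_linear[OF A] H2_expansion])
  moreover have "(\<lambda>N. B (\<Sum>i<N. cinner x (eh i) *\<^sub>C eh i)) \<longlonglongrightarrow> B x"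
    by (rule bounded_linear.tendsto[OF bounded_clinear_bounded_linear[OF B] H2_expansion])
  ultimately show "A x = B x"
    by (simp add: bounded_clinear_sum[OF A] bounded_clinear_scaleC[OF A]
        bounded_clinear_sum[OF B] bounded_clinear_scaleC[OF B] e LIMSEQ_unique)
qed

text \<open>Riesz representation in coordinates: the vector \<open>b\<close> for \<open>y\<close>
  must have the coefficients \<open>cinner y (A (eh i))\<close>. That the adjoint keeps the same
  \<open>K\<close> is used in \<open>hankel_extension\<close>.\<close>

lemma adjoint_exists:
  fixes A :: "H2 \<Rightarrow> H2"
  assumes A: "bounded_clinear A" and K: "0 \<le> K" "\<And>x. norm (A x) \<le> K * norm x"
  shows "\<exists>B. bounded_clinear B \<and> (\<forall>x y. cinner (A x) y = cinner x (B y)) \<and> (\<forall>x. norm (B x) \<le> K * norm x)"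
proof -
  have "\<exists>b. \<forall>x. cinner (A x) y = cinner x b" for y
  proof -
    have bound: "(\<Sum>i<N. (norm (cinner y (A (eh i))))\<^sup>2) \<le> (norm y * K)\<^sup>2" (is "?T \<le> _") for N
    proof (rule le_mult_sqrt_imp)
      \<comment> \<open>The truncated candidate for \<open>b\<close>, used as a test vector: pairing
        \<open>y\<close> with its image under \<open>A\<close> returns the sum of squares.\<close>
      define g where "g = (\<Sum>i<N. cinner y (A (eh i)) *\<^sub>C eh i)"
      have g: "(norm g)\<^sup>2 = ?T"
        unfolding g_def by (rule orthonormal_norm_sum[OF orthonormal_eh]) simp
      then have ng: "norm g = sqrt ?T" by (metis norm_ge_zero real_sqrt_unique)
      have "complex_of_real ?T = cinner y (A g)"
        unfolding g_def bounded_clinear_sum[OF A] bounded_clinear_scaleC[OF A]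
          cinner_sum_right cinner_scaleC_right of_real_sum complex_norm_square
        by (simp add: mult.commute)
      then have "?T \<le> norm (cinner y (A g))"
        by (metis norm_of_real abs_ge_self)
      also have "\<dots> \<le> norm y * (K * norm g)"
        by (intro order_trans[OF norm_cinner_le] mult_left_mono K) simp
      finally show "?T \<le> norm y * K * sqrt ?T" by (simp add: ng mult.assoc)
    qed (use K in \<open>auto simp: sum_nonneg\<close>)
    then obtain b where b: "\<And>i. cinner b (eh i) = cinner y (A (eh i))"
      using H2_riesz_fischer[OF bound] by blast
    have "cinner (A x) y = cinner x b" for x
    proof (rule LIMSEQ_unique)
      let ?s = "\<lambda>N. \<Sum>i<N. cinner x (eh i) *\<^sub>C eh i"
      show "(\<lambda>N. cinner (A (?s N)) y) \<longlonglongrightarrow> cinner (A x) y"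
        by (intro tendsto_cinner_left
            bounded_linear.tendsto[OF bounded_clinear_bounded_linear[OF A]] H2_expansion)
      have "cinner (A (eh i)) y = cinner (eh i) b" for i
        using b[of i] cinner_commute by metis
      then have "cinner (A (?s N)) y = cinner (?s N) b" for N
        by (simp add: bounded_clinear_sum[OF A] bounded_clinear_scaleC[OF A]
            cinner_sum_left cinner_scaleC_left)
      then show "(\<lambda>N. cinner (A (?s N)) y) \<longlonglongrightarrow> cinner x b"
        by (simp add: tendsto_cinner_left[OF H2_expansion])
    qed
    then show ?thesis by blast
  qed
  then obtain B where B: "\<And>x y. cinner (A x) y = cinner x (B y)" by metis
  have B': "cinner (B y) x = cinner y (A x)" for x y
    using B cinner_commute by metis
  have nB: "norm (B x) \<le> K * norm x" for x
  proof -
    have "(norm (B x))\<^sup>2 = norm (cinner (B x) (B x))" by (simp only: cinner_self norm_of_real abs_power2)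
    also have "\<dots> \<le> norm x * (K * norm (B x))"
      unfolding B' by (intro order_trans[OF norm_cinner_le] mult_left_mono K) simp
    finally have "norm (B x) * norm (B x) \<le> (K * norm x) * norm (B x)"
      by (simp add: power2_eq_square mult_ac)
    then show ?thesis
      using K by (cases "B x = 0") (simp_all add: mult_le_cancel_right)
  qed
  have "bounded_clinear B"
  proof (rule bounded_clinearI[OF _ _ nB])
    show "B (x + y) = B x + B y" for x y
      by (rule cinner_left_ext) (simp add: B' cinner_add_left)
    show "B (c *\<^sub>C x) = c *\<^sub>C B x" for c x
      by (rule cinner_left_ext) (simp add: B' cinner_scaleC_left)
  qed
  then show ?thesis using B nB by blast
qed

lemma cadjoint_bounded_clinear:
  fixes A :: "H2 \<Rightarrow> H2"
  assumes A: "bounded_clinear A"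
  shows "bounded_clinear (cadjoint A)" and "cinner (A x) y = cinner x (cadjoint A y)"
    and "cinner (cadjoint A y) x = cinner y (A x)"
proof -
  obtain K where K: "0 < K" "\<And>x. norm (A x) \<le> K * norm x"
    using bounded_clinear_bound[OF A] by blast
  obtain B where B: "bounded_clinear B" "\<And>x y. cinner (A x) y = cinner x (B y)"
    using adjoint_exists[OF A less_imp_le[OF K(1)] K(2)] by blast
  have "cadjoint A = B" by (rule cadjoint_eqI) (rule B(2))
  with B show "bounded_clinear (cadjoint A)" "cinner (A x) y = cinner x (cadjoint A y)"
    by simp_all
  then show "cinner (cadjoint A y) x = cinner y (A x)"
    using cinner_commute by metis
qed

lemma proj_H2_coeff: "cinner (proj_H2 f) (eh n) = fourier_coeff f (int n)"
  and proj_H2_norm: "norm (proj_H2 f) \<le> norm f"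
proof -
  have bound: "(\<Sum>i<N. (norm (fourier_coeff f (int i)))\<^sup>2) \<le> (norm f)\<^sup>2" for N
  proof -
    have "(\<Sum>i<N. (norm (fourier_coeff f (int i)))\<^sup>2) = (\<Sum>i\<in>int ` {..<N}. (norm (fourier_coeff f i))\<^sup>2)"
      by (subst sum.reindex) auto
    also have "\<dots> \<le> (norm f)\<^sup>2"
      using bessel[OF orthonormal_ez, of "int ` {..<N}" f] by (simp add: cinner_ez)
    finally show ?thesis .
  qed
  obtain g where g: "\<And>i. cinner g (eh i) = fourier_coeff f (int i)"
    using H2_riesz_fischer[OF bound] by blast
  \<comment> \<open>Against monomials this is equality of coefficients; density of polynomials
    extends it to all of H^2.\<close>
  have perp: "cinner (f - H2_to_L2 g) (H2_to_L2 h) = 0" for h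
  proof -
    let ?s = "\<lambda>N. \<Sum>i<N. cinner h (eh i) *\<^sub>C eh i"
    have "cinner (f - H2_to_L2 g) (H2_to_L2 (?s N)) = 0" for N
      using g unfolding bounded_clinear_sum[OF H2_to_L2_bounded_clinear]
        bounded_clinear_scaleC[OF H2_to_L2_bounded_clinear] H2_to_L2_eh
      by (simp add: cinner_sum_right cinner_scaleC_right cinner_ez fourier_coeff_diff cinner_eh)
    moreover have "(\<lambda>N. cinner (f - H2_to_L2 g) (H2_to_L2 (?s N)))
        \<longlonglongrightarrow> cinner (f - H2_to_L2 g) (H2_to_L2 h)"
      by (intro bounded_linear.tendsto[OF bounded_linear_cinner_right] H2_expansion
          bounded_linear.tendsto[OF bounded_clinear_bounded_linear[OF H2_to_L2_bounded_clinear]])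
    ultimately show ?thesis by (simp add: LIMSEQ_const_iff)
  qed
  have eq: "proj_H2 f = g"
    unfolding proj_H2_def
  proof (rule the_equality)
    show "\<forall>h. cinner (f - H2_to_L2 g) (H2_to_L2 h) = 0" using perp by blast
    fix g' assume g': "\<forall>h. cinner (f - H2_to_L2 g') (H2_to_L2 h) = 0"
    show "g' = g"
    proof (rule H2_eqI)
      fix n
      have "cinner (f - H2_to_L2 g') (ez (int n)) = 0"
        using g' by (metis H2_to_L2_eh)
      then show "cinner g' (eh n) = cinner g (eh n)"
        by (simp add: g cinner_ez fourier_coeff_diff) (simp add: cinner_eh)
    qed
  qed
  show "cinner (proj_H2 f) (eh n) = fourier_coeff f (int n)" by (simp add: eq g)
  have "(norm f)\<^sup>2 = (norm (f - H2_to_L2 g))\<^sup>2 + (norm (H2_to_L2 g))\<^sup>2"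
    using norm_add_sq[of "f - H2_to_L2 g" "H2_to_L2 g"] by (simp add: perp)
  then have "(norm g)\<^sup>2 \<le> (norm f)\<^sup>2" by (simp add: norm_H2.rep_eq)
  then show "norm (proj_H2 f) \<le> norm f" unfolding eq by (rule power2_le_imp_le) simp
qed

lemma proj_H2_bounded_clinear: "bounded_clinear proj_H2"
proof (rule bounded_clinearI[where K = 1])
  show "proj_H2 (x + y) = proj_H2 x + proj_H2 y" for x y
    by (rule H2_eqI) (simp add: proj_H2_coeff cinner_add_left fourier_coeff_add)
  show "proj_H2 (c *\<^sub>C x) = c *\<^sub>C proj_H2 x" for c x
    by (rule H2_eqI) (simp add: proj_H2_coeff cinner_scaleC_left fourier_coeff_scaleC)
qed (simp add: proj_H2_norm)

lemma toeplitz_bounded_clinear: "\<phi> \<in> Linf \<Longrightarrow> bounded_clinear (toeplitz \<phi>)"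
  unfolding toeplitz_def[abs_def]
  by (intro bounded_clinear_compose[OF proj_H2_bounded_clinear]
      bounded_clinear_compose[OF mult_L2_bounded_clinear] H2_to_L2_bounded_clinear)

lemma hankel_bounded_clinear: "\<phi> \<in> Linf \<Longrightarrow> bounded_clinear (hankel \<phi>)"
  unfolding hankel_def[abs_def]
  by (intro bounded_clinear_compose[OF proj_H2_bounded_clinear]
      bounded_clinear_compose[OF flip_L2_bounded_clinear]
      bounded_clinear_compose[OF mult_L2_bounded_clinear] H2_to_L2_bounded_clinear)

lemma toeplitz_matrix:
  "\<phi> \<in> Linf \<Longrightarrow> cinner (toeplitz \<phi> (eh i)) (eh j) = fourier_coeff \<phi> (int j - int i)"
  by (simp add: toeplitz_def proj_H2_coeff H2_to_L2_eh fourier_coeff_mult_ez)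

text \<open>The flip turns frequency \<open>j\<close> into \<open>- j - 1\<close>, so the entry
  depends on \<open>i + j\<close> and sees negative frequencies of the symbol only.\<close>

lemma hankel_matrix:
  "\<phi> \<in> Linf \<Longrightarrow> cinner (hankel \<phi> (eh i)) (eh j) = fourier_coeff \<phi> (- int i - int j - 1)"
  by (simp add: hankel_def proj_H2_coeff H2_to_L2_eh fourier_coeff_mult_ez fourier_coeff_flip)
     (intro arg_cong[where f = "fourier_coeff \<phi>"], simp)

lemma ez_Linf: "ez n \<in> Linf"
  using AE_norm_powi[of n] by (auto simp: Linf_def ez_def ess_bounded_abs_L2 square_integrable_powi)

lemma shift_eq_toeplitz: "shift = toeplitz (ez 1)"
  by (simp add: shift_def ez_def)

section \<open>The shift and the backward shift\<close>

lemma shift_bounded_clinear: "bounded_clinear shift"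
  unfolding shift_eq_toeplitz by (rule toeplitz_bounded_clinear[OF ez_Linf])

lemma shift_eh: "shift (eh n) = eh (Suc n)"
  by (rule H2_eqI) (auto simp: shift_eq_toeplitz toeplitz_matrix[OF ez_Linf] fourier_coeff_ez cinner_eh_eh)

abbreviation "bshift \<equiv> cadjoint shift"

lemma bshift_bounded_clinear: "bounded_clinear bshift"
  by (rule cadjoint_bounded_clinear(1)[OF shift_bounded_clinear])

lemma cinner_shift: "cinner (shift x) y = cinner x (bshift y)"
  and cinner_bshift: "cinner (bshift x) y = cinner x (shift y)"
  by (rule cadjoint_bounded_clinear[OF shift_bounded_clinear])+

lemma bshift_eh_0: "bshift (eh 0) = 0"
  by (rule H2_eqI) (simp add: cinner_bshift shift_eh cinner_eh_eh cinner_zero_left)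

lemma bshift_eh_Suc: "bshift (eh (Suc n)) = eh n"
  by (rule H2_eqI) (simp add: cinner_bshift shift_eh cinner_eh_eh)

lemma bshift_shift: "bshift (shift x) = x"
proof -
  have "(\<lambda>x. bshift (shift x)) = (\<lambda>x. x)"
  proof (rule H2_operator_eqI)
    show "bounded_clinear (\<lambda>x. bshift (shift x))"
      by (rule bounded_clinear_compose[OF bshift_bounded_clinear shift_bounded_clinear])
    show "bounded_clinear (\<lambda>x::H2. x)"
      by (simp add: bounded_clinear_def bounded_linear_ident)
  qed (simp add: shift_eh bshift_eh_Suc)
  then show ?thesis by (rule fun_cong)
qed

section \<open>Intertwining relations with the shift\<close>

lemma orthonormal_norm_sum_inj:
  assumes e: "orthonormal e" and I: "finite I" and inj: "inj_on f I"
  shows "norm (\<Sum>i\<in>I. c i *\<^sub>C e (f i)) = sqrt (\<Sum>i\<in>I. (norm (c i))\<^sup>2)"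
proof -
  define c' where "c' k = c (the_inv_into I f k)" for k
  have c': "c' (f i) = c i" if "i \<in> I" for i
    using that inj by (simp add: c'_def the_inv_into_f_f)
  have "(\<Sum>i\<in>I. c i *\<^sub>C e (f i)) = (\<Sum>k\<in>f ` I. c' k *\<^sub>C e k)"
    by (simp add: sum.reindex[OF inj] c')
  moreover have "(\<Sum>i\<in>I. (norm (c i))\<^sup>2) = (\<Sum>k\<in>f ` I. (norm (c' k))\<^sup>2)"
    by (simp add: sum.reindex[OF inj] c')
  ultimately have "(norm (\<Sum>i\<in>I. c i *\<^sub>C e (f i)))\<^sup>2 = (\<Sum>i\<in>I. (norm (c i))\<^sup>2)"
    using orthonormal_norm_sum[OF e] I by simp
  then show ?thesis by (metis norm_ge_zero real_sqrt_unique)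
qed

text \<open>The two indices are selected by separate injections: the same translation twice for
  Toeplitz matrices, a translation and a reflection for Hankel matrices. Injectivity makes the norms
  of the test vectors those of \<open>p\<close> and \<open>q\<close>.\<close>

lemma matrix_form_bound:
  fixes A :: "H2 \<Rightarrow> H2"
  assumes A: "bounded_clinear A" and K: "\<And>x. norm (A x) \<le> K * norm x" "0 \<le> K"
    and inj: "finite I" "inj_on f I" "inj_on h I"
    and entries: "\<And>i j. i \<in> I \<Longrightarrow> j \<in> I \<Longrightarrow> cinner (A (eh (f i))) (eh (h j)) = a i j"
  shows "norm (\<Sum>i\<in>I. \<Sum>j\<in>I. a i j * p i * cnj (q j))
    \<le> K * sqrt (\<Sum>i\<in>I. (norm (p i))\<^sup>2) * sqrt (\<Sum>j\<in>I. (norm (q j))\<^sup>2)"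
proof -
  define x where "x = (\<Sum>i\<in>I. p i *\<^sub>C eh (f i))"
  define y where "y = (\<Sum>i\<in>I. q i *\<^sub>C eh (h i))"
  have "(\<Sum>i\<in>I. \<Sum>j\<in>I. a i j * p i * cnj (q j)) = cinner (A x) y"
    unfolding x_def y_def bounded_clinear_sum[OF A] bounded_clinear_scaleC[OF A] cinner_sum_left
    unfolding cinner_sum_right
    by (intro sum.cong refl) (simp add: cinner_scaleC_left cinner_scaleC_right entries mult_ac)
  also have "norm \<dots> \<le> K * norm x * norm y"
    by (intro order_trans[OF norm_cinner_le] mult_right_mono K) simp
  also have "norm x = sqrt (\<Sum>i\<in>I. (norm (p i))\<^sup>2)"
    unfolding x_def by (rule orthonormal_norm_sum_inj[OF orthonormal_eh inj(1,2)])
  also have "norm y = sqrt (\<Sum>i\<in>I. (norm (q i))\<^sup>2)"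
    unfolding y_def by (rule orthonormal_norm_sum_inj[OF orthonormal_eh inj(1,3)])
  finally show ?thesis .
qed

lemma commutes_shift_imp_toeplitz:
  assumes B: "bounded_clinear B" and comm: "\<And>x. shift (B x) = B (shift x)"
  obtains \<phi> where "\<phi> \<in> Hinf" "B = toeplitz \<phi>"
proof -
  obtain K where K: "0 < K" "\<And>x. norm (B x) \<le> K * norm x"
    using bounded_clinear_bound[OF B] by blast
  \<comment> \<open>Zero at negative indices because \<open>bshift (eh 0) = 0\<close> kills the
    entries above the diagonal; hence the symbol comes out analytic.\<close>
  define g where "g n = (if n < 0 then 0 else cinner (B (eh 0)) (eh (nat n)))" for n :: int
  have entry: "cinner (B (eh i)) (eh j) = g (int j - int i)" for i j
  proof (induction i arbitrary: j)
    case 0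
    then show ?case by (simp add: g_def)
  next
    case (Suc i)
    have "cinner (B (eh (Suc i))) (eh j) = cinner (B (eh i)) (bshift (eh j))"
      unfolding shift_eh[symmetric] comm[symmetric] cinner_shift ..
    also have "\<dots> = g (int j - int (Suc i))"
    proof (cases j)
      case 0
      then show ?thesis by (simp add: bshift_eh_0 cinner_zero_right g_def)
    next
      case (Suc j')
      then show ?thesis by (simp add: bshift_eh_Suc Suc.IH)
    qed
    finally show ?case .
  qed
  have "norm (\<Sum>i\<in>freq_window N. \<Sum>j\<in>freq_window N. g (j - i) * p i * cnj (q j))
      \<le> K * sqrt (\<Sum>i\<in>freq_window N. (norm (p i))\<^sup>2) * sqrt (\<Sum>j\<in>freq_window N. (norm (q j))\<^sup>2)" for N p q
  proof (rule matrix_form_bound[OF B K(2) less_imp_le[OF K(1)] finite_freq_window])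
    show "inj_on (\<lambda>i. nat (i + int N)) (freq_window N)" "inj_on (\<lambda>i. nat (i + int N)) (freq_window N)"
      by (auto simp: inj_on_def freq_window_def)
    show "cinner (B (eh (nat (i + int N)))) (eh (nat (j + int N))) = g (j - i)"
      if "i \<in> freq_window N" "j \<in> freq_window N" for i j
      using that by (simp add: entry freq_window_def)
  qed
  then obtain \<phi> where \<phi>: "\<phi> \<in> Linf" "\<And>n. fourier_coeff \<phi> n = g n"
    using laurent_form_imp_Linf[of K g] K(1) by auto
  then have "\<phi> \<in> Hinf" by (simp add: Hinf_def H2_set_def g_def)
  moreover have "B = toeplitz \<phi>"
    by (rule H2_operator_eqI[OF B toeplitz_bounded_clinear[OF \<phi>(1)]])
       (simp add: entry toeplitz_matrix[OF \<phi>(1)] \<phi>(2))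
  ultimately show ?thesis by (rule that)
qed

section \<open>Norm-controlled extension of Hankel operators and Nehari's theorem\<close>

lemma H2_decomposition: "x = cinner x (eh 0) *\<^sub>C eh 0 + shift (bshift x)"
proof (rule H2_eqI)
  fix n
  show "cinner x (eh n) = cinner (cinner x (eh 0) *\<^sub>C eh 0 + shift (bshift x)) (eh n)"
    by (cases n) (simp_all add: cinner_add_left cinner_scaleC_left cinner_eh_eh cinner_shift
        bshift_eh_0 bshift_eh_Suc cinner_zero_right cinner_bshift shift_eh)
qed

text \<open>H^2 is the orthogonal sum of the line of \<open>eh 0\<close> and the range of the
  isometric shift; the norm of the extension is computed in this splitting.\<close>

lemma norm_decomposition: "(norm (a *\<^sub>C eh 0 + shift u))\<^sup>2 = (norm a)\<^sup>2 + (norm u)\<^sup>2"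
proof -
  have "cinner (a *\<^sub>C eh 0) (shift u) = 0"
    by (simp add: cinner_scaleC_left cinner_bshift[symmetric] bshift_eh_0 cinner_zero_left
        bounded_clinear_scaleC[OF bshift_bounded_clinear] scaleC_zero_right)
  moreover have "norm (eh 0) = 1"
    using cinner_self[of "eh 0"] cinner_eh_eh[of 0 0] norm_ge_zero[of "eh 0"]
    by (simp add: power2_eq_1_iff flip: of_real_power)
  moreover have "norm (shift u) = norm u"
  proof -
    have "complex_of_real ((norm (shift u))\<^sup>2) = of_real ((norm u)\<^sup>2)"
      unfolding cinner_self[symmetric] cinner_shift bshift_shift ..
    then show ?thesis by (simp only: of_real_eq_iff power2_eq_iff_nonneg norm_ge_zero)
  qed
  ultimately show ?thesis by (simp add: norm_add_sq norm_scaleC)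
qed

lemma norm_sq_bshift: "(norm x)\<^sup>2 = (norm (cinner x (eh 0)))\<^sup>2 + (norm (bshift x))\<^sup>2"
  using norm_decomposition[of "cinner x (eh 0)" "bshift x"] H2_decomposition[of x] by simp

lemma norm_bshift_le: "norm (bshift x) \<le> norm x"
  by (rule power2_le_imp_le) (simp_all add: norm_sq_bshift[of x])

text \<open>
  Parrott's lemma for a scalar corner. Put \<open>A = S\<^sup>* D\<close>, \<open>c = D e\<^sub>0\<close>, and let \<open>k = c + A w\<close>,
  \<open>w = A\<^sup>* k / \<tau>\<^sup>2\<close>; such \<open>k\<close> exists because \<open>\<parallel>A A\<^sup>*\<parallel> / \<tau>\<^sup>2 < 1\<close>. In the substitution
  \<open>S\<^sup>* f = u + \<langle>f, e\<^sub>0\<rangle> w\<close> the cross terms of \<open>\<parallel>E f\<parallel>\<^sup>2\<close> and \<open>\<tau>\<^sup>2 \<parallel>f\<parallel>\<^sup>2\<close> agree, and the new corner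
  entry is chosen so that the first component of \<open>E f\<close> depends on \<open>u\<close> only.
\<close>

lemma hankel_extension:
  assumes D: "bounded_clinear D" and comm: "\<And>x. bshift (D x) = D (shift x)"
    and bound: "\<And>x. norm (D x) \<le> \<rho> * norm x" and \<rho>: "0 \<le> \<rho>" "\<rho> < \<tau>"
  shows "\<exists>E. bounded_clinear E \<and> (\<forall>x. bshift (E x) = D x) \<and> (\<forall>x. E (shift x) = D x) \<and>
    (\<forall>x. norm (E x) \<le> \<tau> * norm x)"
proof -
  have \<tau>: "0 < \<tau>" using \<rho> by simp
  define A where "A x = bshift (D x)" for x
  have A: "bounded_clinear A"
    unfolding A_def by (rule bounded_clinear_compose[OF bshift_bounded_clinear D])
  obtain D' where D': "bounded_clinear D'" "\<And>x y. cinner (D x) y = cinner x (D' y)"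
      "\<And>x. norm (D' x) \<le> \<rho> * norm x"
    using adjoint_exists[OF D \<rho>(1) bound] by blast
  define A' where "A' x = bshift (D' x)" for x
  have A': "bounded_clinear A'"
    unfolding A'_def by (rule bounded_clinear_compose[OF bshift_bounded_clinear D'(1)])
  \<comment> \<open>By \<open>comm\<close>, \<open>A\<close> is also \<open>D\<close> after the
    shift, so its adjoint is the backward shift after \<open>D'\<close>.\<close>
  have adj: "cinner (A x) y = cinner x (A' y)" for x y
    by (simp add: A_def A'_def comm D'(2) cinner_shift)
  have adj': "cinner (A' y) x = cinner y (A x)" for x y
    using adj cinner_commute by metis
  have nA: "norm (A x) \<le> \<rho> * norm x" for x
    unfolding A_def by (rule order_trans[OF norm_bshift_le bound])
  have nA': "norm (A' x) \<le> \<rho> * norm x" for x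
    unfolding A'_def by (rule order_trans[OF norm_bshift_le D'(3)])
  define c where "c = D (eh 0)"
  define F where "F y = c + (1 / \<tau>\<^sup>2) *\<^sub>R A (A' y)" for y
  have "\<exists>!k. F k = k"
  proof (rule banach_fix_type[of "(\<rho> / \<tau>)\<^sup>2"])
    show "0 \<le> (\<rho> / \<tau>)\<^sup>2" by simp
    show "(\<rho> / \<tau>)\<^sup>2 < 1"
      using \<rho> \<tau> by (simp add: abs_square_less_1)
    show "\<forall>x y. dist (F x) (F y) \<le> (\<rho> / \<tau>)\<^sup>2 * dist x y"
    proof (intro allI)
      fix x y
      have "dist (F x) (F y) = norm ((1 / \<tau>\<^sup>2) *\<^sub>R A (A' (x - y)))"
        by (simp add: F_def dist_norm scaleR_diff_right bounded_clinear_diff[OF A] bounded_clinear_diff[OF A'])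
      also have "\<dots> = norm (A (A' (x - y))) / \<tau>\<^sup>2" by simp
      also have "\<dots> \<le> (\<rho> * (\<rho> * norm (x - y))) / \<tau>\<^sup>2"
        by (intro divide_right_mono order_trans[OF nA] mult_left_mono nA' \<rho>) simp
      also have "\<dots> = (\<rho> / \<tau>)\<^sup>2 * dist x y"
        by (simp add: dist_norm power2_eq_square)
      finally show "dist (F x) (F y) \<le> (\<rho> / \<tau>)\<^sup>2 * dist x y" .
    qed
  qed
  then obtain k where k: "F k = k" by blast
  define w where "w = complex_of_real (1 / \<tau>\<^sup>2) *\<^sub>C A' k"
  have k_eq: "k = c + A w"
    using k by (simp add: F_def w_def scaleR_scaleC bounded_clinear_scaleC[OF A])
  have wu: "of_real (\<tau>\<^sup>2) * cinner w u = cinner k (A u)" for u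
  proof -
    have "of_real (\<tau>\<^sup>2) * cinner w u = (of_real (\<tau>\<^sup>2) * of_real (1 / \<tau>\<^sup>2)) * cinner (A' k) u"
      by (simp add: w_def cinner_scaleC_left del: of_real_power of_real_divide)
    also have "of_real (\<tau>\<^sup>2) * of_real (1 / \<tau>\<^sup>2) = (1::complex)"
      unfolding of_real_mult[symmetric] using \<tau> by simp
    finally show ?thesis by (simp add: adj')
  qed
  have nw: "norm w = norm (A' k) / \<tau>\<^sup>2"
    by (simp add: w_def norm_scaleC norm_divide norm_power del: of_real_divide of_real_power)
  \<comment> \<open>\<open>t\<close> will be the inner product of \<open>c\<close> and
    \<open>k\<close>; the estimate \<open>t \<le> \<tau>\<^sup>2\<close> is exactly what the
    comparison of the \<alpha> terms needs.\<close>
  define t where "t = (norm k)\<^sup>2 - \<tau>\<^sup>2 * (norm w)\<^sup>2"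
  have ck: "cinner c k = of_real t"
  proof -
    have "cinner (A w) k = cinner w (A' k)" by (rule adj)
    also have "A' k = of_real (\<tau>\<^sup>2) *\<^sub>C w"
      using \<tau> by (simp add: w_def scaleC_scaleC scaleC_one flip: of_real_power of_real_divide of_real_mult)
    also have "cinner w (of_real (\<tau>\<^sup>2) *\<^sub>C w) = of_real (\<tau>\<^sup>2 * (norm w)\<^sup>2)"
      unfolding cinner_scaleC_right cinner_self by simp
    finally have Aw: "cinner (A w) k = of_real (\<tau>\<^sup>2 * (norm w)\<^sup>2)" .
    have "cinner k k = cinner c k + cinner (A w) k"
      using k_eq by (metis cinner_add_left)
    then show ?thesis
      unfolding cinner_self Aw t_def of_real_diff by simp
  qed
  \<comment> \<open>\<open>D' k\<close> has a zeroth coefficient of modulus |t| and the backward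
    shift \<open>A' k\<close>. Its norm bound becomes \<open>t * t \<le> \<tau>\<^sup>2 * t\<close>
    once the norm of \<open>A' k\<close> is expressed by that of \<open>w\<close>.\<close>
  have "t \<le> \<tau>\<^sup>2"
  proof -
    have "norm (cinner (D' k) (eh 0)) = \<bar>t\<bar>"
      using D'(2)[of "eh 0" k] cinner_commute[of "D' k" "eh 0"] ck
      by (simp add: c_def)
    then have "t\<^sup>2 + (norm (A' k))\<^sup>2 = (norm (D' k))\<^sup>2"
      using norm_sq_bshift[of "D' k"] by (simp add: A'_def)
    also have "\<dots> \<le> (\<rho> * norm k)\<^sup>2"
      by (intro power_mono D') simp
    also have "\<dots> \<le> (\<tau> * norm k)\<^sup>2"
      using \<rho> by (intro power_mono mult_right_mono) auto
    finally have "t\<^sup>2 \<le> \<tau>\<^sup>2 * (norm k)\<^sup>2 - (norm (A' k))\<^sup>2"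
      by (simp add: power_mult_distrib)
    also have "(norm (A' k))\<^sup>2 = \<tau>\<^sup>2 * (\<tau>\<^sup>2 * (norm w)\<^sup>2)"
      unfolding nw using \<tau> by (simp add: power2_eq_square)
    also have "\<tau>\<^sup>2 * (norm k)\<^sup>2 - \<tau>\<^sup>2 * (\<tau>\<^sup>2 * (norm w)\<^sup>2) = \<tau>\<^sup>2 * t"
      by (simp add: t_def algebra_simps)
    finally have *: "t * t \<le> \<tau>\<^sup>2 * t" by (simp add: power2_eq_square)
    show ?thesis
    proof (cases "t \<le> 0")
      case True
      then show ?thesis by (rule order_trans) simp
    next
      case False
      then show ?thesis using * by (simp add: mult_le_cancel_right)
    qed
  qed
  \<comment> \<open>The component in the range of the shift is forced by
    \<open>bshift (E f) = D f\<close>; the new corner entry is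
    \<open>- cinner (D w) (eh 0)\<close>.\<close>
  define E where "E f = (cinner (D (bshift f - cinner f (eh 0) *\<^sub>C w)) (eh 0)) *\<^sub>C eh 0 + shift (D f)" for f
  have nE: "norm (E f) \<le> \<tau> * norm f" for f
  proof (rule power2_le_imp_le)
    define \<alpha> where "\<alpha> = cinner f (eh 0)"
    define u where "u = bshift f - \<alpha> *\<^sub>C w"
    have f: "f = \<alpha> *\<^sub>C eh 0 + shift (u + \<alpha> *\<^sub>C w)"
      using H2_decomposition[of f] by (simp add: \<alpha>_def u_def)
    have Df: "D f = \<alpha> *\<^sub>C k + A u"
    proof -
      have "D f = D (\<alpha> *\<^sub>C eh 0 + shift (u + \<alpha> *\<^sub>C w))" by (subst f) (rule refl)
      also have "\<dots> = \<alpha> *\<^sub>C c + A (u + \<alpha> *\<^sub>C w)"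
        unfolding A_def comm c_def bounded_clinear_add[OF D, of "\<alpha> *\<^sub>C eh 0"] bounded_clinear_scaleC[OF D] ..
      also have "\<dots> = \<alpha> *\<^sub>C (c + A w) + A u"
        by (simp add: bounded_clinear_add[OF A] bounded_clinear_scaleC[OF A] scaleC_add_right)
      finally show ?thesis using k_eq by simp
    qed
    have "E f = cinner (D u) (eh 0) *\<^sub>C eh 0 + shift (D f)"
      by (simp add: E_def u_def \<alpha>_def)
    then have "(norm (E f))\<^sup>2 = (norm (cinner (D u) (eh 0)))\<^sup>2 + (norm (\<alpha> *\<^sub>C k + A u))\<^sup>2"
      by (simp only: norm_decomposition Df)
    \<comment> \<open>The first component and \<open>A u\<close> recombine by
      \<open>norm_sq_bshift\<close>: together they have the norm of \<open>D u\<close>.\<close>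
    also have "\<dots> = (norm (D u))\<^sup>2 + 2 * Re (\<alpha> * cinner k (A u)) + (norm \<alpha>)\<^sup>2 * (norm k)\<^sup>2"
      by (simp add: norm_add_sq norm_scaleC power_mult_distrib cinner_scaleC_left norm_sq_bshift[of "D u"] A_def)
    also have "\<dots> \<le> \<tau>\<^sup>2 * (norm u)\<^sup>2 + 2 * Re (\<alpha> * cinner k (A u)) + (norm \<alpha>)\<^sup>2 * (\<tau>\<^sup>2 + \<tau>\<^sup>2 * (norm w)\<^sup>2)"
    proof (intro add_mono order_refl mult_left_mono)
      have "(norm (D u))\<^sup>2 \<le> (\<rho> * norm u)\<^sup>2" by (intro power_mono bound) simp
      also have "\<dots> \<le> (\<tau> * norm u)\<^sup>2"
        using \<rho> by (intro power_mono mult_right_mono) auto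
      finally show "(norm (D u))\<^sup>2 \<le> \<tau>\<^sup>2 * (norm u)\<^sup>2" by (simp add: power_mult_distrib)
      show "(norm k)\<^sup>2 \<le> \<tau>\<^sup>2 + \<tau>\<^sup>2 * (norm w)\<^sup>2"
        using \<open>t \<le> \<tau>\<^sup>2\<close> by (simp add: t_def)
    qed simp
    also have "Re (\<alpha> * cinner k (A u)) = \<tau>\<^sup>2 * Re (\<alpha> * cinner w u)"
    proof -
      have "\<alpha> * cinner k (A u) = of_real (\<tau>\<^sup>2) * (\<alpha> * cinner w u)"
        by (simp add: wu[symmetric] mult_ac)
      then show ?thesis by (simp only: Re_complex_of_real times_complex.sel Im_complex_of_real)
    qed
    also have "\<tau>\<^sup>2 * (norm u)\<^sup>2 + 2 * (\<tau>\<^sup>2 * Re (\<alpha> * cinner w u)) + (norm \<alpha>)\<^sup>2 * (\<tau>\<^sup>2 + \<tau>\<^sup>2 * (norm w)\<^sup>2)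
        = \<tau>\<^sup>2 * ((norm \<alpha>)\<^sup>2 + (norm (\<alpha> *\<^sub>C w + u))\<^sup>2)"
      unfolding norm_add_sq norm_scaleC power_mult_distrib cinner_scaleC_left by (simp add: algebra_simps)
    also have "\<dots> = (\<tau> * norm f)\<^sup>2"
      by (subst f) (simp add: norm_decomposition power_mult_distrib add.commute)
    finally show "(norm (E f))\<^sup>2 \<le> (\<tau> * norm f)\<^sup>2" .
  qed (use \<tau> in simp)
  have "bounded_clinear E"
  proof (rule bounded_clinearI[OF _ _ nE])
    show "E (x + y) = E x + E y" for x y
      by (simp add: E_def bounded_clinear_add[OF D] bounded_clinear_add[OF shift_bounded_clinear]
          bounded_clinear_add[OF bshift_bounded_clinear] bounded_clinear_diff[OF D]
          bounded_clinear_scaleC[OF D] cinner_add_left cinner_diff_left scaleC_add_left cinner_scaleC_left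
          algebra_simps flip: scaleC_add_left)
    show "E (a *\<^sub>C x) = a *\<^sub>C E x" for a x
      by (simp add: E_def bounded_clinear_scaleC[OF D] bounded_clinear_scaleC[OF shift_bounded_clinear]
          bounded_clinear_scaleC[OF bshift_bounded_clinear] bounded_clinear_diff[OF D]
          cinner_diff_left cinner_scaleC_left scaleC_add_right scaleC_scaleC algebra_simps)
  qed
  moreover have "bshift (E x) = D x" for x
    by (simp add: E_def bounded_clinear_add[OF bshift_bounded_clinear] bshift_shift
        bounded_clinear_scaleC[OF bshift_bounded_clinear] bshift_eh_0 scaleC_zero_right)
  \<comment> \<open>On the range of the shift the coefficient at \<open>eh 0\<close> is 0, so
    \<open>w\<close> drops out and the decomposition of \<open>D x\<close> reappears.\<close>
  moreover have "E (shift x) = D x" for x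
    using H2_decomposition[of "D x"]
    by (simp add: E_def bshift_shift cinner_shift bshift_eh_0 cinner_zero_right scaleC_zero_left comm)
  ultimately show ?thesis using nE by blast
qed

text \<open>All extensions \<open>X n\<close> display one sequence \<open>g\<close>, with
  \<open>g (n - 1)\<close> in the corner of \<open>X n\<close>; reversing one index of a large
  \<open>X n\<close> therefore shows a full window of a Laurent matrix.\<close>

lemma intertwines_shift_imp_hankel:
  assumes D: "bounded_clinear D" and comm: "\<And>x. bshift (D x) = D (shift x)"
  obtains \<psi> where "\<psi> \<in> Linf" "D = hankel \<psi>"
proof -
  obtain K where K: "0 < K" "\<And>x. norm (D x) \<le> K * norm x"
    using bounded_clinear_bound[OF D] by blast
  \<comment> \<open>The extension step needs strictly increasing bounds; these stay below \<open>2 K\<close>.\<close>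
  define \<tau> where "\<tau> n = K * (2 - (1/2) ^ n)" for n :: nat
  \<comment> \<open>The clause for \<open>n = 0\<close> ties the sequence to \<open>D\<close>, since
    dependent choice controls its start only through \<open>P\<close>.\<close>
  define P where "P n X \<longleftrightarrow> bounded_clinear X \<and> (\<forall>x. bshift (X x) = X (shift x)) \<and>
    (\<forall>x. norm (X x) \<le> \<tau> n * norm x) \<and> (n = 0 \<longrightarrow> X = D)" for n X
  have "\<exists>X. \<forall>n. P n (X n) \<and>
      ((\<forall>x. bshift (X (Suc n) x) = X n x) \<and> (\<forall>x. X (Suc n) (shift x) = X n x))"
  proof (rule dependent_nat_choice)
    show "\<exists>X. P 0 X"
      using D comm K(2) by (auto simp: P_def \<tau>_def)
    fix X n
    assume X: "P n X"
    have "0 \<le> \<tau> n"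
      using K(1) power_le_one[of "1/2::real" n] unfolding \<tau>_def by (intro mult_nonneg_nonneg) auto
    moreover have "\<tau> n < \<tau> (Suc n)"
      using K(1) by (simp add: \<tau>_def)
    ultimately obtain E where "bounded_clinear E" "\<And>x. bshift (E x) = X x" "\<And>x. E (shift x) = X x"
        "\<And>x. norm (E x) \<le> \<tau> (Suc n) * norm x"
      using hankel_extension[of X "\<tau> n" "\<tau> (Suc n)"] X unfolding P_def by blast
    then show "\<exists>Y. P (Suc n) Y \<and> (\<forall>x. bshift (Y x) = X x) \<and> (\<forall>x. Y (shift x) = X x)"
      by (auto simp: P_def)
  qed
  then obtain X where X: "\<And>n. P n (X n)" and bX: "\<And>n x. bshift (X (Suc n) x) = X n x"
    and sX: "\<And>n x. X (Suc n) (shift x) = X n x"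
    by blast
  define d where "d n i j = cinner (X n (eh i)) (eh j)" for n i j
  have d1: "d (Suc n) (Suc i) j = d n i j" for n i j
    by (simp add: d_def shift_eh[symmetric] sX)
  have d2: "d (Suc n) i (Suc j) = d n i j" for n i j
    by (simp add: d_def shift_eh[symmetric] cinner_bshift[symmetric] bX)
  \<comment> \<open>Passing through the next extension trades a step in \<open>j\<close> for a step
    in \<open>i\<close>.\<close>
  have d3: "d n i j = d n (i + j) 0" for n i j
  proof (induction j arbitrary: i)
    case (Suc j)
    have "d n i (Suc j) = d n (Suc i) j" by (metis d1 d2)
    then show ?case using Suc[of "Suc i"] by simp
  qed simp
  have d4: "d (n + k) (i + k) 0 = d n i 0" for n i k
    by (induction k) (simp_all add: d1)
  \<comment> \<open>For \<open>m < 0\<close>, \<open>nat\<close> truncates the step number to 0 and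
    the entry is read from \<open>D\<close>; for \<open>m \<ge> 0\<close> it is the corner of
    \<open>X (m + 1)\<close>, where this coefficient first occurs.\<close>
  define g where "g m = d (nat (m + 1)) (nat (- m - 1)) 0" for m :: int
  have d5: "d n i 0 = g (int n - int i - 1)" for n i
  proof (cases "i \<le> n")
    case True
    then show ?thesis using d4[of "n - i" i 0] by (simp add: g_def nat_diff_distrib)
  next
    case False
    then show ?thesis using d4[of 0 n "i - n"] by (simp add: g_def nat_diff_distrib)
  qed
  have entry: "cinner (X n (eh i)) (eh j) = g (int n - int i - int j - 1)" for n i j
    using d3[of n i j] d5[of n "i + j"] by (simp add: d_def algebra_simps)
  have "norm (\<Sum>i\<in>freq_window N. \<Sum>j\<in>freq_window N. g (j - i) * p i * cnj (q j))
      \<le> (2 * K) * sqrt (\<Sum>i\<in>freq_window N. (norm (p i))\<^sup>2) * sqrt (\<Sum>j\<in>freq_window N. (norm (q j))\<^sup>2)" for N p q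
  proof (rule matrix_form_bound)
    \<comment> \<open>The differences \<open>j - i\<close> in the window reach \<open>2 * N\<close>,
      the frequency in the corner of \<open>X (2 * N + 1)\<close>.\<close>
    show "bounded_clinear (X (2 * N + 1))" using X by (auto simp: P_def)
    show "norm (X (2 * N + 1) x) \<le> 2 * K * norm x" for x
    proof (rule order_trans)
      show "norm (X (2 * N + 1) x) \<le> \<tau> (2 * N + 1) * norm x" using X by (auto simp: P_def)
      show "\<tau> (2 * N + 1) * norm x \<le> 2 * K * norm x"
        using K(1) by (intro mult_right_mono) (simp_all add: \<tau>_def)
    qed
    \<comment> \<open>Reflecting the second index turns dependence on a sum into dependence on
      \<open>j - i\<close>.\<close>
    show "inj_on (\<lambda>i. nat (i + int N)) (freq_window N)" "inj_on (\<lambda>j. nat (int N - j)) (freq_window N)"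
      by (auto simp: inj_on_def freq_window_def)
    show "cinner (X (2 * N + 1) (eh (nat (i + int N)))) (eh (nat (int N - j))) = g (j - i)"
      if "i \<in> freq_window N" "j \<in> freq_window N" for i j
      using that by (simp add: entry freq_window_def)
  qed (use K(1) finite_freq_window in auto)
  then obtain \<psi> where \<psi>: "\<psi> \<in> Linf" "\<And>n. fourier_coeff \<psi> n = g n"
    using laurent_form_imp_Linf[of "2 * K" g] K(1) by auto
  have "X 0 = D" using X[of 0] by (simp add: P_def)
  then have "D = hankel \<psi>"
    using entry[of 0]
    by (intro H2_operator_eqI[OF D hankel_bounded_clinear[OF \<psi>(1)]])
       (simp add: hankel_matrix[OF \<psi>(1)] \<psi>(2))
  with \<psi>(1) show ?thesis by (rule that)
qed

section \<open>The vanishing corner, and the relations satisfied by Toeplitz and Hankel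
  operators\<close>

lemma shift_commute_eq_0:
  assumes A: "bounded_clinear A" and comm: "\<And>x. shift (A x) = A (bshift x)"
  shows "A x = 0"
proof -
  have "A (eh i) = 0" for i
  proof (induction i)
    case 0
    have "A (eh 0) = bshift (A (bshift (eh 0)))"
      unfolding comm[symmetric] bshift_shift ..
    then show ?case
      by (simp add: bshift_eh_0 bounded_clinear_zero[OF A] bounded_clinear_zero[OF bshift_bounded_clinear])
  next
    case (Suc i)
    have "A (eh (Suc i)) = bshift (A (bshift (eh (Suc i))))"
      unfolding comm[symmetric] bshift_shift ..
    then show ?case
      by (simp add: bshift_eh_Suc Suc bounded_clinear_zero[OF bshift_bounded_clinear])
  qed
  moreover have "bounded_clinear (\<lambda>_::H2. 0::H2)"
    by (simp add: bounded_clinear_def scaleC_zero_right bounded_linear_zero)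
  ultimately have "A = (\<lambda>_. 0)"
    by (intro H2_operator_eqI[OF A]) simp_all
  then show ?thesis by simp
qed

text \<open>Analyticity enters only at \<open>j = 0\<close>: the left entry vanishes there, and the
  right one is the coefficient of \<open>\<phi>\<close> at \<open>- (i + 1)\<close>.\<close>

lemma toeplitz_commutes_shift:
  assumes "\<phi> \<in> Hinf"
  shows "shift (toeplitz \<phi> x) = toeplitz \<phi> (shift x)"
proof -
  have \<phi>: "\<phi> \<in> Linf" and neg: "\<And>n. n < 0 \<Longrightarrow> fourier_coeff \<phi> n = 0"
    using assms by (auto simp: Hinf_def H2_set_def)
  note T = toeplitz_bounded_clinear[OF \<phi>]
  have "(\<lambda>x. shift (toeplitz \<phi> x)) = (\<lambda>x. toeplitz \<phi> (shift x))"
  proof (rule H2_operator_eqI)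
    fix i j
    show "cinner (shift (toeplitz \<phi> (eh i))) (eh j) = cinner (toeplitz \<phi> (shift (eh i))) (eh j)"
      by (cases j) (simp_all add: cinner_shift shift_eh bshift_eh_0 bshift_eh_Suc toeplitz_matrix[OF \<phi>]
          neg cinner_zero_right)
  qed (rule bounded_clinear_compose[OF shift_bounded_clinear T],
      rule bounded_clinear_compose[OF T shift_bounded_clinear])
  then show ?thesis by (rule fun_cong)
qed

text \<open>Raising either index of a Hankel matrix has the same effect: both entries have frequency
  \<open>- i - j - 2\<close>.\<close>

lemma hankel_intertwines_shift:
  assumes \<psi>: "\<psi> \<in> Linf"
  shows "bshift (hankel \<psi> x) = hankel \<psi> (shift x)"
proof -
  note H = hankel_bounded_clinear[OF \<psi>]
  have "(\<lambda>x. bshift (hankel \<psi> x)) = (\<lambda>x. hankel \<psi> (shift x))"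
  proof (rule H2_operator_eqI)
    fix i j
    show "cinner (bshift (hankel \<psi> (eh i))) (eh j) = cinner (hankel \<psi> (shift (eh i))) (eh j)"
      by (simp add: cinner_bshift shift_eh hankel_matrix[OF \<psi>] algebra_simps)
  qed (rule bounded_clinear_compose[OF bshift_bounded_clinear H],
      rule bounded_clinear_compose[OF H shift_bounded_clinear])
  then show ?thesis by (rule fun_cong)
qed

lemma cadjoint_toeplitz_commutes_bshift:
  assumes "\<phi> \<in> Hinf"
  shows "bshift (cadjoint (toeplitz \<phi>) x) = cadjoint (toeplitz \<phi>) (bshift x)"
proof (rule cinner_left_ext)
  fix z
  have "bounded_clinear (toeplitz \<phi>)"
    using assms by (auto simp: Hinf_def intro: toeplitz_bounded_clinear)
  note adj = cadjoint_bounded_clinear(3)[OF this]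
  show "cinner (bshift (cadjoint (toeplitz \<phi>) x)) z = cinner (cadjoint (toeplitz \<phi>) (bshift x)) z"
    by (simp add: cinner_bshift adj toeplitz_commutes_shift[OF assms, symmetric])
qed

section \<open>Block decomposition over the direct sum\<close>

lemma cadjoint_sum_shift_bshift:
  "cadjoint (map_prod shift bshift) = map_prod bshift shift"
  by (rule cadjoint_eqI) (auto simp: cinner_prod_def cinner_shift cinner_bshift)

lemma bounded_clinear_entries:
  fixes Y :: "'a::complex_inner \<times> 'b::complex_inner \<Rightarrow> 'c::complex_inner \<times> 'd::complex_inner"
  assumes Y: "bounded_clinear Y"
  shows "bounded_clinear (\<lambda>x. fst (Y (x, 0)))" "bounded_clinear (\<lambda>y. fst (Y (0, y)))"
    "bounded_clinear (\<lambda>x. snd (Y (x, 0)))" "bounded_clinear (\<lambda>y. snd (Y (0, y)))"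
proof -
  have f: "bounded_clinear (fst :: 'c \<times> 'd \<Rightarrow> 'c)" and s: "bounded_clinear (snd :: 'c \<times> 'd \<Rightarrow> 'd)"
    by (simp_all add: bounded_clinear_def scaleC_prod_def bounded_linear_fst bounded_linear_snd)
  have "bounded_clinear (\<lambda>x::'a. (x, 0::'b))" "bounded_clinear (\<lambda>y::'b. (0::'a, y))"
    by (auto simp: bounded_clinear_def scaleC_prod_def scaleC_zero_right
        intro: bounded_linear_Pair bounded_linear_ident bounded_linear_zero)
  note c = this[THEN bounded_clinear_compose[OF Y]]
  show "bounded_clinear (\<lambda>x. fst (Y (x, 0)))" "bounded_clinear (\<lambda>y. fst (Y (0, y)))"
    "bounded_clinear (\<lambda>x. snd (Y (x, 0)))" "bounded_clinear (\<lambda>y. snd (Y (0, y)))"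
    by (fact bounded_clinear_compose[OF f c(1)] bounded_clinear_compose[OF f c(2)]
        bounded_clinear_compose[OF s c(1)] bounded_clinear_compose[OF s c(2)])+
qed

lemma bounded_clinear_eq_block_op:
  fixes Y :: "'a::complex_inner \<times> 'b::complex_inner \<Rightarrow> 'c::complex_inner \<times> 'd::complex_inner"
  assumes Y: "bounded_clinear Y"
  shows "Y = block_op (\<lambda>x. fst (Y (x, 0))) (\<lambda>y. fst (Y (0, y))) (\<lambda>x. snd (Y (x, 0))) (\<lambda>y. snd (Y (0, y)))"
proof
  fix p :: "'a \<times> 'b"
  obtain x y where p: "p = (x, y)" by (cases p)
  have "Y p = Y (x, 0) + Y (0, y)"
    unfolding p bounded_clinear_add[OF Y, symmetric] by simp
  then show "Y p = block_op (\<lambda>x. fst (Y (x, 0))) (\<lambda>y. fst (Y (0, y))) (\<lambda>x. snd (Y (x, 0))) (\<lambda>y. snd (Y (0, y))) p"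
    by (simp add: p block_op_def prod_eq_iff)
qed

theorem theorem3p6:
  fixes Y :: "H2 \<times> H2 \<Rightarrow> H2 \<times> H2"
  assumes "bounded_clinear Y"
  shows "map_prod shift (cadjoint shift) \<circ> Y = Y \<circ> cadjoint (map_prod shift (cadjoint shift)) \<longleftrightarrow>
    (\<exists>\<phi>12\<in>Hinf. \<exists>\<phi>21\<in>Hinf. \<exists>\<psi>\<in>Linf.
      Y = block_op (\<lambda>_. 0) (toeplitz \<phi>12) (cadjoint (toeplitz \<phi>21)) (hankel \<psi>))"
    (is "?intertwines \<longleftrightarrow> ?blocks")
proof
  assume ?intertwines
  define A B C D where "A x = fst (Y (x, 0))" and "B x = fst (Y (0, x))"
    and "C x = snd (Y (x, 0))" and "D x = snd (Y (0, x))" for x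
  have A: "bounded_clinear A" and B: "bounded_clinear B" and C: "bounded_clinear C" and D: "bounded_clinear D"
    unfolding A_def B_def C_def D_def by (fact bounded_clinear_entries[OF assms])+
  have Y: "Y = block_op A B C D"
    using bounded_clinear_eq_block_op[OF assms] unfolding A_def B_def C_def D_def .
  have eq: "map_prod shift bshift (Y p) = Y (map_prod bshift shift p)" for p
    using fun_cong[OF \<open>?intertwines\<close>, of p] by (simp add: cadjoint_sum_shift_bshift)
  have zeros: "A 0 = 0" "B 0 = 0" "C 0 = 0" "D 0 = 0" "shift 0 = 0" "bshift 0 = 0"
    using A B C D shift_bounded_clinear bshift_bounded_clinear by (simp_all add: bounded_clinear_zero)
  \<comment> \<open>Vectors with one zero component separate the relation into its four
    entries.\<close>
  have comm: "shift (A x) = A (bshift x)" "shift (B x) = B (shift x)"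
      "bshift (C x) = C (bshift x)" "bshift (D x) = D (shift x)" for x
    using eq[of "(x, 0)"] eq[of "(0, x)"] by (simp_all add: Y block_op_def zeros)
  have "A = (\<lambda>_. 0)" using shift_commute_eq_0[OF A comm(1)] by auto
  moreover obtain \<phi>12 where "\<phi>12 \<in> Hinf" "B = toeplitz \<phi>12"
    using commutes_shift_imp_toeplitz[OF B comm(2)] .
  \<comment> \<open>For the adjoint of \<open>C\<close> the relation becomes commutation with the
    shift; taking the adjoint again returns \<open>C\<close>.\<close>
  moreover obtain \<phi>21 where "\<phi>21 \<in> Hinf" "C = cadjoint (toeplitz \<phi>21)"
  proof -
    note adj = cadjoint_bounded_clinear[OF C]
    have "shift (cadjoint C x) = cadjoint C (shift x)" for x
      by (rule cinner_left_ext) (simp add: adj(3) cinner_shift comm(3))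
    with adj(1) obtain \<phi> where "\<phi> \<in> Hinf" "cadjoint C = toeplitz \<phi>"
      using commutes_shift_imp_toeplitz by blast
    moreover have "cadjoint (cadjoint C) = C"
      by (rule cadjoint_eqI) (rule adj(3))
    ultimately show ?thesis using that by metis
  qed
  moreover obtain \<psi> where "\<psi> \<in> Linf" "D = hankel \<psi>"
    using intertwines_shift_imp_hankel[OF D comm(4)] .
  ultimately show ?blocks using Y by blast
next
  assume ?blocks
  then obtain \<phi>12 \<phi>21 \<psi> where \<phi>12: "\<phi>12 \<in> Hinf" and \<phi>21: "\<phi>21 \<in> Hinf" and \<psi>: "\<psi> \<in> Linf"
    and Y: "Y = block_op (\<lambda>_. 0) (toeplitz \<phi>12) (cadjoint (toeplitz \<phi>21)) (hankel \<psi>)"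
    by blast
  have T21: "bounded_clinear (toeplitz \<phi>21)"
    using \<phi>21 by (simp add: Hinf_def toeplitz_bounded_clinear)
  show ?intertwines
    unfolding cadjoint_sum_shift_bshift
    by (rule ext) (auto simp: Y block_op_def toeplitz_commutes_shift[OF \<phi>12]
        bounded_clinear_zero[OF shift_bounded_clinear] bounded_clinear_add[OF bshift_bounded_clinear]
        hankel_intertwines_shift[OF \<psi>] cadjoint_toeplitz_commutes_bshift[OF \<phi>21])
qed

end
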